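(* Let $A_{\mathsf L},B_{\mathsf L},C_{\mathsf L}\in\mathbb C^{N\times N}$ and let $W$ be a regular Laguerre type matrix of weights on $\gamma$ satisfying $$zW'(z)=(A_{\mathsf L}+B_{\mathsf L}z+C_{\mathsf L}z^2)W(z),$$ and let $\beta_n^{\mathsf L},\gamma_n^{\mathsf L}$ be the recursion coefficients of the monic left orthogonal polynomials of $W$. When $B_{\mathsf L}=0_N$, the following nonlocal nonlinear non-Abelian system for the recursion coefficients is fulfilled: $$(2n+1)I_N+A_{\mathsf L}+C_{\mathsf L}(\gamma_{n+1}^{\mathsf L}+\gamma_n^{\mathsf L})+C_{\mathsf L}(\beta_n^{\mathsf L})^2=\Big[\sum_{k=0}^{n-1}\beta_k^{\mathsf L},C_{\mathsf L}\Big]\sum_{k=0}^{n}\beta_k^{\mathsf L}-\Big[\sum_{i,j=0}^{n-1}\beta_i^{\mathsf L}\beta_j^{\mathsf L}-\sum_{k=0}^{n-1}\gamma_k^{\mathsf L},\,C_{\mathsf L}\Big],$$ $$\beta_n^{\mathsf L}-\gamma_n^{\mathsf L}\big(C_{\mathsf L}(\beta_n^{\mathsf L}+\beta_{n-1}^{\mathsf L})\big)+\big(C_{\mathsf L}(\beta_n^{\mathsf L}+\beta_{n+1}^{\mathsf L})\big)\gamma_{n+1}^{\mathsf L}=-\gamma_n^{\mathsf L}\Big[\sum_{k=0}^{n-1}\beta_k^{\mathsf L},C_{\mathsf L}\Big]+\Big[-\sum_{k=0}^{n-1}\beta_k^{\mathsf L},C_{\mathsf L}\Big]\gamma_{n+1}^{\mathsf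 L}.$$ Moreover, this system reduces in the commutative context to the standard discrete Painlevé IV (dPIV) equation.
   Context: $N\ge1$; $I_N,0_N$ are the $N\times N$ identity and zero matrices; $\mathbb N=\{0,1,2,\dots\}$; $[X,Y]=XY-YX$. $\gamma\subset\mathbb C$ is a non self-intersecting smooth curve with one end point at $0$ and the other at $\infty$, meeting each circle $|z|=R$, $R>0$, once and only once. Laguerre type matrix of weights: an $N\times N$ matrix function $W$ with support $\gamma$ and entries of the form $W^{(j,k)}(z)=\sum_{m\in I_{j,k}}h_m(z)z^{\alpha_m}\log^{p_m}z$, $z\in\gamma$, where $I_{j,k}$ is a finite index set, $\alpha_m>-1$, $p_m\in\mathbb N$, and $h_m$ is Hölder continuous, bounded and non-vanishing on $\gamma$, with a holomorphic extension to $\mathbb C$; logarithm and powers are determined along $\gamma$. It is regular if its moments $W_n=\frac1{2\pi i}\int_\gamma z^nW(z)\,dz$ satisfy $\det[W_{j+k}]_{j,k=0,\dots,n}\ne0$ for all $n\in\mathbb N$. Left orthogonal polynomials: $P_n^{\mathsf L}$ is the monic matrix polynomial of degree $n$ such that $\frac1{2\pi i}\int_\gamma P_n^{\mathsf L}(z)W(z)z^k\,dz=\delta_{n,k}C_n^{-1}$ for $k=0,\dots,n$, with $C_n$ nonsingular. They satisfy the three term recurrence relation $$zP_n^{\mathsf L}(z)=P_{n+1}^{\mathsf L}(z)+\beta_n^{\mathsf L}P_n^{\mathsf L}(z)+\gamma_n^{\mathsf L}P_{n-1}^{\mathsf L}(z),\quad n\in\mathbb N,\qquad P_{-1}^{\mathsf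 L}=0_N,\ P_0^{\mathsf L}=I_N,$$ with $\gamma_n^{\mathsf L}=C_n^{-1}C_{n-1}$. Commutative context: the matrices $A_{\mathsf L},C_{\mathsf L}$ (with $B_{\mathsf L}=0_N$) form an Abelian set; in that setting, according to the paper, the set formed by these matrices together with the $\beta_n^{\mathsf L},\gamma_n^{\mathsf L}$ is Abelian too, and the commutators on the right-hand sides vanish. The dPIV equation referred to is the instance of Grammaticos, Hietarinta and Ramani, which the paper writes, with $\xi_n:=\frac{A_{\mathsf L}}2+nI_N+C_{\mathsf L}\gamma_n^{\mathsf L}$, as $$(\xi_n+\xi_{n+1})(\xi_{n+1}+\xi_{n+2})=\Big(\big(\xi_{n+1}-A_{\mathsf L}/2-nI_N\big)^{-1}\big(\xi_{n+1}^2-\xi_0^2\big)\Big)^2.$$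
   Formalization: Printed formulas that fail are corrected: in the first equation the sum of β_iβ_j runs over j<i≤n−1; the second has right side −γ_n[Σ_{k≤n−2}β_k,C]+[Σ_{k≤n−1}β_k,C]γ_{n+1}; in dPIV the inverted matrix is ξ_{n+1}−A/2−(n+1)I. *)

theory Defs
  imports "HOL-Analysis.Analysis"
begin

type_synonym 'n cmat = "complex ^ 'n ^ 'n"

definition cscale :: "complex \<Rightarrow> 'n::finite cmat \<Rightarrow> 'n cmat"  (infixr "*\<^sub>m" 75)
  where "c *\<^sub>m M = (\<chi> i j. c * M $ i $ j)"

definition commutator :: "'n::finite cmat \<Rightarrow> 'n cmat \<Rightarrow> 'n cmat"
  where "commutator X Y = X ** Y - Y ** X"

text \<open>Leibniz determinant of a matrix indexed by a finite set; for the universe of a finite type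
  this is the library determinant. It is needed because the size of the block moment matrices
  varies, so it cannot be encoded in a type.\<close>

definition det_on :: "'i set \<Rightarrow> ('i \<Rightarrow> 'i \<Rightarrow> complex) \<Rightarrow> complex"
  where "det_on S M = (\<Sum>p | p permutes S. of_int (sign p) * (\<Prod>i\<in>S. M i (p i)))"

text \<open>The convention that objects with index \<open>-1\<close> are zero.\<close>

definition prev :: "(nat \<Rightarrow> 'a::zero) \<Rightarrow> nat \<Rightarrow> 'a"
  where "prev f n = (case n of 0 \<Rightarrow> 0 | Suc m \<Rightarrow> f m)"


subsection \<open>The curve\<close>

text \<open>The curve is given by a parametrization of \<open>[0, \<infinity>)\<close>; smooth means continuously differentiable
  with nowhere vanishing derivative (one-sided at the end point \<open>0\<close>). The values of the
  parametrization at negative arguments are irrelevant.\<close>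

definition laguerre_curve :: "(real \<Rightarrow> complex) \<Rightarrow> bool"
  where "laguerre_curve g \<longleftrightarrow>
    (\<exists>g'. continuous_on {0..} g' \<and>
       (\<forall>t\<in>{0..}. (g has_vector_derivative g' t) (at t within {0..}) \<and> g' t \<noteq> 0)) \<and>
    g 0 = 0 \<and> filterlim g at_infinity at_top \<and> inj_on g {0..} \<and>
    (\<forall>R>0. \<exists>!z. z \<in> g ` {0..} \<and> cmod z = R)"

text \<open>Integrals along the curve are gauge integrals, which include the conditionally convergent
  improper ones.\<close>

definition curve_integrable :: "(real \<Rightarrow> complex) \<Rightarrow> (complex \<Rightarrow> 'n::finite cmat) \<Rightarrow> bool"
  where "curve_integrable g F \<longleftrightarrow>
    (\<lambda>t. vector_derivative g (at t within {0..}) *\<^sub>m F (g t)) integrable_on {0..}"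

definition curve_integral :: "(real \<Rightarrow> complex) \<Rightarrow> (complex \<Rightarrow> 'n::finite cmat) \<Rightarrow> 'n cmat"
  where "curve_integral g F =
    integral {0..} (\<lambda>t. vector_derivative g (at t within {0..}) *\<^sub>m F (g t))"


subsection \<open>Laguerre type matrices of weights\<close>

definition holder_on :: "complex set \<Rightarrow> (complex \<Rightarrow> complex) \<Rightarrow> bool"
  where "holder_on S f \<longleftrightarrow>
    (\<exists>K \<mu>. 0 < \<mu> \<and> \<mu> \<le> 1 \<and> (\<forall>x\<in>S. \<forall>y\<in>S. cmod (f x - f y) \<le> K * cmod (x - y) powr \<mu>))"

definition log_branch :: "complex set \<Rightarrow> (complex \<Rightarrow> complex) \<Rightarrow> bool"
  where "log_branch S l \<longleftrightarrow> continuous_on S l \<and> (\<forall>z\<in>S. exp (l z) = z)"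

text \<open>A single branch \<open>l\<close> of the logarithm along the curve determines all logarithms and all powers
  \<open>z\<^sup>\<alpha> = exp (\<alpha> log z)\<close>. The functions \<open>h m\<close> are identified with their entire extensions. The value
  of the weight at the end point \<open>0\<close> is irrelevant.\<close>

definition laguerre_weight :: "(real \<Rightarrow> complex) \<Rightarrow> (complex \<Rightarrow> 'n::finite cmat) \<Rightarrow> bool"
  where "laguerre_weight g W \<longleftrightarrow>
    (\<exists>l. log_branch (g ` {0<..}) l \<and>
      (\<forall>j k. \<exists>(I :: nat set) (h :: nat \<Rightarrow> complex \<Rightarrow> complex) (\<alpha> :: nat \<Rightarrow> real) (p :: nat \<Rightarrow> nat).
        finite I \<and>
        (\<forall>m\<in>I. \<alpha> m > -1 \<and> h m holomorphic_on UNIV \<and> holder_on (g ` {0..}) (h m) \<and>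
           bounded (h m ` g ` {0..}) \<and> (\<forall>z\<in>g ` {0..}. h m z \<noteq> 0)) \<and>
        (\<forall>z\<in>g ` {0<..}. W z $ j $ k =
           (\<Sum>m\<in>I. h m z * exp (of_real (\<alpha> m) * l z) * l z ^ p m))))"

definition moment :: "(real \<Rightarrow> complex) \<Rightarrow> (complex \<Rightarrow> 'n::finite cmat) \<Rightarrow> nat \<Rightarrow> 'n cmat"
  where "moment g W n = (1 / (2 * of_real pi * \<i>)) *\<^sub>m curve_integral g (\<lambda>z. z ^ n *\<^sub>m W z)"

definition regular_weight :: "(real \<Rightarrow> complex) \<Rightarrow> (complex \<Rightarrow> 'n::finite cmat) \<Rightarrow> bool"
  where "regular_weight g W \<longleftrightarrow>
    (\<forall>n. curve_integrable g (\<lambda>z. z ^ n *\<^sub>m W z)) \<and>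
    (\<forall>n. det_on ({0..n} \<times> (UNIV :: 'n set)) (\<lambda>(j, a) (k, b). moment g W (j + k) $ a $ b) \<noteq> 0)"

text \<open>The equation \<open>z W' = (A + B z + C z\<^sup>2) W\<close>, with the derivative taken entrywise along the curve.\<close>

definition pearson_equation ::
    "(real \<Rightarrow> complex) \<Rightarrow> (complex \<Rightarrow> 'n::finite cmat) \<Rightarrow> 'n cmat \<Rightarrow> 'n cmat \<Rightarrow> 'n cmat \<Rightarrow> bool"
  where "pearson_equation g W A B C \<longleftrightarrow>
    (\<forall>z\<in>g ` {0<..}. \<exists>W'.
       (\<forall>j k. ((\<lambda>x. W x $ j $ k) has_field_derivative W' $ j $ k) (at z within g ` {0<..})) \<and>
       z *\<^sub>m W' = (A + z *\<^sub>m B + z ^ 2 *\<^sub>m C) ** W z)"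


subsection \<open>Left orthogonal polynomials and their recursion coefficients\<close>

definition monic_matrix_poly :: "nat \<Rightarrow> (complex \<Rightarrow> 'n::finite cmat) \<Rightarrow> bool"
  where "monic_matrix_poly n P \<longleftrightarrow>
    (\<exists>a. a n = mat 1 \<and> (\<forall>z. P z = (\<Sum>k\<le>n. z ^ k *\<^sub>m a k)))"

definition left_orthogonal_polys ::
    "(real \<Rightarrow> complex) \<Rightarrow> (complex \<Rightarrow> 'n::finite cmat) \<Rightarrow> (nat \<Rightarrow> complex \<Rightarrow> 'n cmat) \<Rightarrow>
     (nat \<Rightarrow> 'n cmat) \<Rightarrow> bool"
  where "left_orthogonal_polys g W P H \<longleftrightarrow>
    (\<forall>n. monic_matrix_poly n (P n) \<and> invertible (H n) \<and>
       (\<forall>k\<le>n. (1 / (2 * of_real pi * \<i>)) *\<^sub>m curve_integral g (\<lambda>z. z ^ k *\<^sub>m (P n z ** W z)) =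
          (if k = n then matrix_inv (H n) else 0)))"

text \<open>In particular \<open>\<gamma> 0 = 0\<close>, by the convention on \<open>prev\<close>.\<close>

definition recursion_coefficients ::
    "(nat \<Rightarrow> complex \<Rightarrow> 'n::finite cmat) \<Rightarrow> (nat \<Rightarrow> 'n cmat) \<Rightarrow>
     (nat \<Rightarrow> 'n cmat) \<Rightarrow> (nat \<Rightarrow> 'n cmat) \<Rightarrow> bool"
  where "recursion_coefficients P H \<beta> \<gamma> \<longleftrightarrow>
    (\<forall>n z. z *\<^sub>m P n z = P (Suc n) z + \<beta> n ** P n z + \<gamma> n ** prev (\<lambda>m. P m z) n) \<and>
    (\<forall>n. \<gamma> n = matrix_inv (H n) ** prev H n)"


subsection \<open>The commutative context\<close>

definition abelian_set :: "'n::finite cmat set \<Rightarrow> bool"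
  where "abelian_set S \<longleftrightarrow> (\<forall>X\<in>S. \<forall>Y\<in>S. X ** Y = Y ** X)"

definition xi :: "'n::finite cmat \<Rightarrow> 'n cmat \<Rightarrow> (nat \<Rightarrow> 'n cmat) \<Rightarrow> nat \<Rightarrow> 'n cmat"
  where "xi A C \<gamma> n = (1 / 2) *\<^sub>m A + mat (of_nat n) + C ** \<gamma> n"

text \<open>The shift by \<open>n + 1\<close> belongs to the index of \<open>\<xi> (n + 1)\<close>: the matrix \<open>D\<close> is
  \<open>C ** \<gamma> (n + 1)\<close>. With a shift by \<open>n\<close> instead, the equation already fails in the scalar case
  for the weight \<open>exp (- z\<^sup>2 / 2)\<close> on the positive half-line.\<close>

definition dPIV :: "'n::finite cmat \<Rightarrow> 'n cmat \<Rightarrow> (nat \<Rightarrow> 'n cmat) \<Rightarrow> bool"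
  where "dPIV A C \<gamma> \<longleftrightarrow>
    (let \<xi> = xi A C \<gamma> in
     \<forall>n. let D = \<xi> (n + 1) - (1 / 2) *\<^sub>m A - mat (of_nat (n + 1));
             R = matrix_inv D ** (\<xi> (n + 1) ** \<xi> (n + 1) - \<xi> 0 ** \<xi> 0)
         in invertible D \<and>
            (\<xi> n + \<xi> (n + 1)) ** (\<xi> (n + 1) + \<xi> (n + 2)) = R ** R)"

end

theory Submission imports Defs begin

text \<open>Integrating \<open>(z\<^sup>k\<^sup>+\<^sup>1 W)'\<close> along the curve gives the moment recursion
  \<open>(k + 1) M\<^sub>k + A M\<^sub>k + C M\<^sub>k\<^sub>+\<^sub>2 = 0\<close>: no boundary terms appear because all moments converge.
  Hence the operator \<open>Q \<mapsto> z Q' + Q + Q A + z\<^sup>2 Q C\<close> is adjoint to \<open>- z d/dz\<close>, and it maps the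
  orthogonal polynomial \<open>P\<^sub>n\<close> to a combination \<open>C P\<^sub>n\<^sub>+\<^sub>2 + E\<^sub>n P\<^sub>n\<^sub>+\<^sub>1 - n P\<^sub>n\<close>. Comparing the coefficients
  of \<open>z\<^sup>n\<close> gives the first equation, and compatibility with multiplication by \<open>z\<close> gives the second.

  If \<open>A\<close> and \<open>C\<close> commute, then by uniqueness for the linear differential equation every matrix
  commuting with both also commutes with the normalized weight \<open>W W(g(1))\<^sup>-\<^sup>1\<close>, therefore with its
  moments and with the recursion coefficients. So these lie in the commutant and, being
  themselves in the bicommutant, commute with each other. In the commutative case
  \<open>\<xi>\<^sub>n + \<xi>\<^sub>n\<^sub>+\<^sub>1 = - C \<beta>\<^sub>n\<^sup>2\<close>, and multiplying the second equation by \<open>C \<beta>\<^sub>n\<close> makes it telescope to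
  \<open>\<xi>\<^sub>n\<^sup>2 - \<xi>\<^sub>0\<^sup>2 = C\<^sup>2 \<gamma>\<^sub>n \<beta>\<^sub>n \<beta>\<^sub>n\<^sub>-\<^sub>1\<close>.\<close>

subsection \<open>Square complex matrices\<close>

lemma cscale_simps:
  fixes X Y :: "complex ^ 'n ^ 'n"
  shows cscale_add_right: "c *\<^sub>m (X + Y) = c *\<^sub>m X + c *\<^sub>m Y"
    and cscale_diff_right: "c *\<^sub>m (X - Y) = c *\<^sub>m X - c *\<^sub>m Y"
    and cscale_minus_right: "c *\<^sub>m (- X) = - (c *\<^sub>m X)"
    and cscale_add_left: "(c + d) *\<^sub>m X = c *\<^sub>m X + d *\<^sub>m X"
    and cscale_diff_left: "(c - d) *\<^sub>m X = c *\<^sub>m X - d *\<^sub>m X"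
    and cscale_minus_left: "(- c) *\<^sub>m X = - (c *\<^sub>m X)"
    and cscale_cscale: "c *\<^sub>m d *\<^sub>m X = (c * d) *\<^sub>m X"
    and cscale_one: "1 *\<^sub>m X = X"
    and cscale_two: "2 *\<^sub>m X = 2 * X"
    and cscale_double: "(2 * c) *\<^sub>m X = 2 * (c *\<^sub>m X)" "(c * 2) *\<^sub>m X = 2 * (c *\<^sub>m X)"
    and cscale_zero_left: "0 *\<^sub>m X = 0"
    and cscale_zero_right: "c *\<^sub>m (0 :: complex ^ 'n ^ 'n) = 0"
    and cscale_mult_left: "(c *\<^sub>m X) ** Y = c *\<^sub>m (X ** Y)"
    and cscale_mult_right: "X ** (c *\<^sub>m Y) = c *\<^sub>m (X ** Y)"
  by (simp_all add: cscale_def vec_eq_iff matrix_matrix_mult_def algebra_simps sum_distrib_left)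

lemma cscale_eq_0: "c *\<^sub>m X = 0 \<longleftrightarrow> c = 0 \<or> (X :: complex ^ 'n ^ 'n) = 0"
  by (auto simp: cscale_def vec_eq_iff)

lemma matrix_mult_distribs:
  fixes X Y Z :: "complex ^ 'n ^ 'n"
  shows "X ** (Y + Z) = X ** Y + X ** Z" "(Y + Z) ** X = Y ** X + Z ** X"
    "X ** (Y - Z) = X ** Y - X ** Z" "(Y - Z) ** X = Y ** X - Z ** X"
    "X ** (- Y) = - (X ** Y)" "(- Y) ** X = - (Y ** X)"
    "X ** 0 = 0" "0 ** X = 0"
  by (simp_all add: vec_eq_iff matrix_matrix_mult_def algebra_simps sum.distrib
      sum_subtractf sum_negf)

lemmas matrix_mult_simps = matrix_mult_distribs matrix_mul_assoc[symmetric]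

lemma matrix_mult_sum_left:
  fixes f :: "'i \<Rightarrow> complex ^ 'n ^ 'n"
  shows "(\<Sum>i\<in>I. f i) ** (X :: complex ^ 'n ^ 'n) = (\<Sum>i\<in>I. f i ** X)"
  by (induction I rule: infinite_finite_induct) (simp_all add: matrix_mult_simps)

lemma matrix_mult_sum_right:
  fixes f :: "'i \<Rightarrow> complex ^ 'n ^ 'n"
  shows "(X :: complex ^ 'n ^ 'n) ** (\<Sum>i\<in>I. f i) = (\<Sum>i\<in>I. X ** f i)"
  by (induction I rule: infinite_finite_induct) (simp_all add: matrix_mult_simps)

lemma mat_eq_cscale: "mat c = c *\<^sub>m mat 1"
  by (simp add: mat_def cscale_def vec_eq_iff)

lemma invertible_matrix_inv_mult:
  fixes X :: "complex ^ 'n ^ 'n"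
  assumes "invertible X"
  shows "X ** matrix_inv X = mat 1" "matrix_inv X ** X = mat 1" "invertible (matrix_inv X)"
proof -
  have "X ** matrix_inv X = mat 1 \<and> matrix_inv X ** X = mat 1"
    using assms unfolding invertible_def matrix_inv_def by (rule someI_ex)
  then show "X ** matrix_inv X = mat 1" "matrix_inv X ** X = mat 1" "invertible (matrix_inv X)"
    by (auto simp: invertible_def)
qed

lemma invertible_cancel_right:
  fixes X Y :: "complex ^ 'n ^ 'n"
  assumes "invertible Y" "X ** Y = 0"
  shows "X = 0"
  by (metis assms invertible_matrix_inv_mult(1) matrix_mul_assoc matrix_mul_rid matrix_mult_simps(8))

lemma invertible_if_right_mult_eq_0:
  fixes Y :: "complex ^ 'n ^ 'n"
  assumes "\<And>X :: complex ^ 'n ^ 'n. Y ** X = 0 \<Longrightarrow> X = 0"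
  shows "invertible Y"
proof -
  have "x = 0" if "Y *v x = 0" for x
  proof -
    \<comment> \<open>All columns of \<open>X\<close> equal \<open>x\<close>, which turns the
      hypothesis on matrices into a statement about the kernel of \<open>Y\<close>.\<close>
    define X :: "complex ^ 'n ^ 'n" where "X = (\<chi> i j. x $ i)"
    have "Y ** X = 0"
      using that by (simp add: X_def vec_eq_iff matrix_matrix_mult_def matrix_vector_mult_def)
    from assms[OF this] show ?thesis by (simp add: X_def vec_eq_iff)
  qed
  then show ?thesis
    using matrix_left_invertible_ker[of Y] invertible_left_inverse by blast
qed

lemma invertible_if_left_mult_eq_0:
  fixes Y :: "complex ^ 'n ^ 'n"
  assumes "\<And>X :: complex ^ 'n ^ 'n. X ** Y = 0 \<Longrightarrow> X = 0"
  shows "invertible Y"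
proof -
  have "invertible (transpose Y)"
  proof (rule invertible_if_right_mult_eq_0)
    fix X :: "complex ^ 'n ^ 'n" assume "transpose Y ** X = 0"
    then have "transpose (transpose Y ** X) = 0"
      by (simp add: transpose_def vec_eq_iff)
    then have "transpose X ** Y = 0"
      by (simp add: matrix_transpose_mul)
    then have "transpose X = 0"
      by (rule assms)
    then show "X = 0"
      by (simp add: transpose_def vec_eq_iff)
  qed
  then show ?thesis
    by (metis invertible_left_inverse invertible_right_inverse left_invertible_transpose)
qed

section \<open>Multiplication by z on coefficient sequences\<close>

lemma prev_simps [simp]: "prev f 0 = 0" "prev f (Suc n) = f n"
  by (simp_all add: prev_def)

lemma prev_linear:
  fixes p q :: "nat \<Rightarrow> complex ^ 'n ^ 'n"
  shows "prev (\<lambda>j. p j + q j) = (\<lambda>j. prev p j + prev q j)"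
    and "prev (\<lambda>j. X ** q j) = (\<lambda>j. X ** prev q j)"
  by (auto simp: prev_def fun_eq_iff matrix_mult_simps split: nat.split)

text \<open>On coefficient sequences \<open>prev\<close> is multiplication by z; the identity moves
  this factor over to the sequence \<open>M\<close>.\<close>

lemma sum_prev_shift:
  fixes f :: "nat \<Rightarrow> complex ^ 'n ^ 'n"
  shows "(\<Sum>j<Suc n. prev f j ** M j) = (\<Sum>j<n. f j ** M (Suc j))"
  by (subst sum.lessThan_Suc_shift) (simp add: matrix_mult_simps)

lemmas matrix_simps = matrix_mult_simps cscale_simps

subsection \<open>Recursion coefficients from the moment recursion\<close>

text \<open>The algebraic setting: \<open>M k\<close> is the k-th moment, \<open>a n k\<close> the
  coefficient of z^k in P_n, and \<open>G n\<close> the nonsingular value obtained by pairing P_n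
  with z^n.\<close>

locale laguerre_recursion =
  fixes A C :: "complex ^ 'n ^ 'n"
    and M :: "nat \<Rightarrow> complex ^ 'n ^ 'n"
    and a :: "nat \<Rightarrow> nat \<Rightarrow> complex ^ 'n ^ 'n"
    and G \<beta> \<gamma> :: "nat \<Rightarrow> complex ^ 'n ^ 'n"
  assumes moment_recursion: "of_nat (k + 1) *\<^sub>m M k + A ** M k + C ** M (k + 2) = 0"
    and coeff_lead: "a n n = mat 1"
    and coeff_degree: "n < k \<Longrightarrow> a n k = 0"
    and orthogonality: "k \<le> n \<Longrightarrow> (\<Sum>j\<le>n. a n j ** M (j + k)) = (if k = n then G n else 0)"
    and invertible_G: "invertible (G n)"
    and recurrence: "prev (a n) k = a (Suc n) k + \<beta> n ** a n k + \<gamma> n ** prev (\<lambda>m. a m k) n"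
    and gamma_0: "\<gamma> 0 = 0"
begin

section \<open>Pairing with powers of z and orthogonality\<close>

text \<open>The integral of Q W z^k divided by 2 pi i, where Q has the coefficients
  \<open>q j\<close>. The cut-off \<open>N\<close> is explicit so that polynomials of different
  degrees share one sum, which makes linearity immediate.\<close>

definition pairing :: "nat \<Rightarrow> (nat \<Rightarrow> complex ^ 'n ^ 'n) \<Rightarrow> nat \<Rightarrow> complex ^ 'n ^ 'n"
  where "pairing N q k = (\<Sum>j<N. q j ** M (j + k))"

lemma pairing_linear:
  "pairing N (\<lambda>j. p j + q j) k = pairing N p k + pairing N q k"
  "pairing N (\<lambda>j. p j - q j) k = pairing N p k - pairing N q k"
  "pairing N (\<lambda>j. X ** q j) k = X ** pairing N q k"
  "pairing N (\<lambda>j. c *\<^sub>m q j) k = c *\<^sub>m pairing N q k"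
proof -
  have cs: "c *\<^sub>m sum f I = (\<Sum>i\<in>I. c *\<^sub>m f i)" for f :: "nat \<Rightarrow> complex ^ 'n ^ 'n" and I
    by (induction I rule: infinite_finite_induct) (simp_all add: matrix_simps)
  show "pairing N (\<lambda>j. p j + q j) k = pairing N p k + pairing N q k"
    "pairing N (\<lambda>j. p j - q j) k = pairing N p k - pairing N q k"
    "pairing N (\<lambda>j. X ** q j) k = X ** pairing N q k"
    "pairing N (\<lambda>j. c *\<^sub>m q j) k = c *\<^sub>m pairing N q k"
    unfolding pairing_def
    by (simp_all add: matrix_simps sum.distrib sum_subtractf matrix_mult_sum_right cs)
qed

lemma pairing_coeff:
  assumes "n < N" "k \<le> n"
  shows "pairing N (a n) k = (if k = n then G n else 0)"
proof -
  have "pairing N (a n) k = (\<Sum>j\<le>n. a n j ** M (j + k))"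
    unfolding pairing_def
    by (rule sum.mono_neutral_right) (use assms in \<open>auto simp: coeff_degree matrix_simps\<close>)
  with orthogonality[OF assms(2)] show ?thesis by simp
qed

text \<open>Subtracting \<open>q n ** a n\<close> removes the top coefficient and keeps the lower
  pairings zero, so by induction the rest vanishes. Pairing with z^n then gives
  \<open>q n ** G n = 0\<close>, and \<open>G n\<close> is nonsingular.\<close>

lemma orthogonal_unique:
  assumes "\<And>j. n \<le> j \<Longrightarrow> q j = 0" "n \<le> N" "\<And>k. k < n \<Longrightarrow> pairing N q k = 0"
  shows "q j = 0"
  using assms
proof (induction n arbitrary: q j)
  case 0
  then show ?case by simp
next
  case (Suc n)
  define r where "r = (\<lambda>j. q j - q n ** a n j)"
  have r: "r i = 0" for i
  proof (rule Suc.IH)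
    fix j assume "n \<le> j"
    then show "r j = 0"
      by (cases "j = n") (auto simp: r_def coeff_lead coeff_degree Suc.prems(1) matrix_simps)
  next
    show "n \<le> N" using Suc.prems by simp
    fix k assume "k < n"
    then show "pairing N r k = 0"
      using Suc.prems by (simp add: r_def pairing_linear pairing_coeff matrix_simps)
  qed
  have q: "q i = q n ** a n i" for i using r[of i] unfolding r_def by (simp only: right_minus_eq)
  have "pairing N q n = pairing N (\<lambda>j. q n ** a n j) n"
    unfolding pairing_def by (rule sum.cong[OF refl]) (rule arg_cong[OF q])
  also have "\<dots> = q n ** G n"
    using Suc.prems(2) by (simp add: pairing_linear pairing_coeff)
  finally have "q n = 0" using Suc.prems(3)[of n] invertible_cancel_right[OF invertible_G] by simp
  then show ?case by (subst q) (simp add: matrix_mult_simps)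
qed

text \<open>Coefficients of \<open>z Q' + Q + Q A + z\<^sup>2 Q C\<close>, the polynomial by which \<open>W\<close> is multiplied
  in \<open>(z Q W)'\<close>.\<close>

definition pearson_op :: "(nat \<Rightarrow> complex ^ 'n ^ 'n) \<Rightarrow> nat \<Rightarrow> complex ^ 'n ^ 'n"
  where "pearson_op q j = of_nat (j + 1) *\<^sub>m q j + q j ** A + prev (prev q) j ** C"

text \<open>Integration by parts in coefficient form: when the right-hand side is moved to the left,
  each \<open>q j\<close> is multiplied by the moment recursion at index j + k. The two extra places
  of the cut-off hold the degree raised by z^2 Q C.\<close>

lemma pairing_pearson_op:
  assumes "\<And>j. N \<le> j \<Longrightarrow> q j = 0"
  shows "pairing (N + 2) (pearson_op q) k = - (of_nat k *\<^sub>m pairing (N + 2) q k)"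
proof -
  have "pairing (N + 2) (\<lambda>j. prev (prev q) j ** C) k = (\<Sum>j<N. q j ** (C ** M (j + 2 + k)))"
    by (simp add: pairing_def matrix_mult_simps sum_prev_shift del: sum.lessThan_Suc)
  also have "\<dots> = (\<Sum>j<N + 2. q j ** (C ** M (j + 2 + k)))"
    by (rule sum.mono_neutral_left) (auto simp: assms matrix_simps)
  finally have 1: "pairing (N + 2) (\<lambda>j. prev (prev q) j ** C) k = \<dots>" .
  have "pairing (N + 2) (pearson_op q) k + of_nat k *\<^sub>m pairing (N + 2) q k
      = pairing (N + 2) (\<lambda>j. of_nat (j + k + 1) *\<^sub>m q j + q j ** A) k
        + pairing (N + 2) (\<lambda>j. prev (prev q) j ** C) k"
    unfolding pearson_op_def pairing_linear(4)[symmetric] pairing_linear(1)[symmetric]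
    by (rule arg_cong[where f = "\<lambda>f. pairing _ f _"]) (auto simp: matrix_simps)
  also have "\<dots> = (\<Sum>j<N + 2. q j ** (of_nat (j + k + 1) *\<^sub>m M (j + k) + A ** M (j + k)
      + C ** M (j + k + 2)))"
    unfolding 1 unfolding pairing_def sum.distrib[symmetric]
    by (rule sum.cong) (auto simp: matrix_simps add_ac)
  also have "\<dots> = 0"
    unfolding moment_recursion by (simp add: matrix_simps)
  finally show ?thesis by (simp add: eq_neg_iff_add_eq_0)
qed

section \<open>Subleading coefficients and the structure relation\<close>

text \<open>\<open>p1 n\<close> and \<open>p2 n\<close> are the coefficients of z^(n-1) and z^(n-2)
  in P_n, zero when the exponent is negative. \<open>E n\<close> is the coefficient of P_{n+1} in
  the structure relation, read off from z^(n+1).\<close>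

definition p1 where "p1 n = prev (a n) n"
definition p2 where "p2 n = prev (prev (a n)) n"
definition E where "E n = p1 n ** C - C ** p1 (n + 2)"

text \<open>The coefficient of z^n in the three term recurrence; z^(n-1) similarly gives the
  recursion for \<open>p2\<close>.\<close>

lemma p1_Suc: "p1 (Suc n) = p1 n - \<beta> n"
  using recurrence[of n n]
  by (cases n) (auto simp: p1_def coeff_lead coeff_degree matrix_simps eq_neg_iff_add_eq_0)

lemma p1_eq: "p1 n = - (\<Sum>k<n. \<beta> k)"
  by (induction n) (auto simp: p1_Suc, simp add: p1_def)

lemma p2_Suc: "p2 (Suc n) = p2 n - \<beta> n ** p1 n - \<gamma> n"
proof (cases n)
  case 0
  then show ?thesis by (simp add: p1_def p2_def gamma_0 matrix_simps)
next
  case (Suc m)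
  then show ?thesis using recurrence[of n m]
    by (simp add: p1_def p2_def coeff_lead matrix_simps)
qed

text \<open>The recursion puts the newest \<beta> on the left of all earlier ones. Hence the double
  sum runs over pairs with j < i only, and the order of the factors matters.\<close>

lemma p2_eq: "p2 n = (\<Sum>i<n. \<Sum>j<i. \<beta> i ** \<beta> j) - (\<Sum>k<n. \<gamma> k)"
  by (induction n)
    (simp_all add: p2_Suc p1_eq matrix_simps matrix_mult_sum_right, simp add: p2_def)

text \<open>The difference of both sides has degree at most n, because the coefficients of z^(n+1)
  and z^(n+2) cancel. It pairs to zero with z^k for k \<le> n: at k = n the value - n
  \<open>G n\<close> from the adjoint is cancelled by the term - n P_n.\<close>

lemma structure_relation:
  "pearson_op (a n) j = C ** a (n + 2) j + E n ** a (n + 1) j - of_nat n *\<^sub>m a n j"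
proof -
  define q where
    "q = (\<lambda>j. pearson_op (a n) j - (C ** a (n + 2) j + E n ** a (n + 1) j - of_nat n *\<^sub>m a n j))"
  have "q j = 0" for j
  proof (rule orthogonal_unique)
    fix j assume "Suc n \<le> j"
    then consider "j = n + 1" | "j = n + 2" | "n + 2 < j" by linarith
    then show "q j = 0"
    proof cases
      assume "n + 2 < j"
      then obtain i where "j = Suc (Suc i)" "i > n" by (metis Suc_less_eq2 add_2_eq_Suc')
      then show ?thesis by (simp add: q_def pearson_op_def coeff_degree matrix_simps)
    qed (simp_all add: q_def pearson_op_def coeff_degree coeff_lead E_def p1_def matrix_simps)
  next
    \<comment> \<open>The cut-off must exceed n + 2 to cover P_{n+2}; its form \<open>_ + 2\<close>
      is the one of \<open>pairing_pearson_op\<close>.\<close>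
    show "Suc n \<le> n + 3 + 2" by simp
    fix k assume "k < Suc n"
    moreover have "pairing (n + 3 + 2) (pearson_op (a n)) k = - (of_nat k *\<^sub>m pairing (n + 3 + 2) (a n) k)"
      by (rule pairing_pearson_op) (simp add: coeff_degree)
    ultimately show "pairing (n + 3 + 2) q k = 0"
      by (auto simp: q_def pairing_linear pairing_coeff matrix_simps)
  qed
  then show ?thesis by (simp add: q_def)
qed

text \<open>This is the coefficient of z^n in \<open>structure_relation\<close>; the n + 1 from the
  operator and the n from the right-hand side add up to 2n + 1. Expanding \<open>p2 (n + 2)\<close>
  down to \<open>p2 n\<close> leaves the second commutator.\<close>

lemma first_equation:
  "of_nat (2 * n + 1) *\<^sub>m mat 1 + A + C ** (\<gamma> (n + 1) + \<gamma> n) + C ** (\<beta> n ** \<beta> n)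
    = commutator (\<Sum>k<n. \<beta> k) C ** (\<Sum>k\<le>n. \<beta> k)
      - commutator ((\<Sum>i<n. \<Sum>j<i. \<beta> i ** \<beta> j) - (\<Sum>k<n. \<gamma> k)) C"
proof -
  have s: "(\<Sum>k<n. \<beta> k) = - p1 n" "(\<Sum>k\<le>n. \<beta> k) = - p1 (Suc n)"
    by (simp_all add: p1_eq lessThan_Suc_atMost)
  have "p2 n = prev (prev (a n)) n" "p2 (n+2) = a (n + 2) n" "p1 (Suc n) = a (Suc n) n"
    by (simp_all add: p1_def p2_def)
  then have "of_nat (2 * n + 1) *\<^sub>m mat 1 + A + p2 n ** C - C ** p2 (n + 2) - E n ** p1 (Suc n) = 0"
    using structure_relation[of n n]
    by (simp add: pearson_op_def coeff_lead matrix_simps algebra_simps)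
  then show ?thesis
    unfolding s p2_eq[symmetric] commutator_def E_def
    by (simp add: p2_Suc p1_Suc matrix_simps algebra_simps)
qed

section \<open>Compatibility with multiplication by z\<close>

lemma op_linear: 
  "pearson_op (\<lambda>j. p j + q j) j = pearson_op p j + pearson_op q j"
  "pearson_op (\<lambda>j. X ** q j) j = X ** pearson_op q j"
  by (simp_all add: pearson_op_def prev_linear matrix_simps)

text \<open>The product rule for z Q: the operator commutes with multiplication by z up to z Q
  itself.\<close>

lemma op_prev: "pearson_op (prev q) j = prev (pearson_op q) j + prev q j"
  by (cases j) (simp_all add: pearson_op_def matrix_simps)

text \<open>The operator is applied to z P_n in two ways, through \<open>op_prev\<close> and through
  the recurrence, and both results are expanded in the orthogonal polynomials.\<close>

lemma second_equation_E: "\<beta> n - \<gamma> n ** E (n - 1) + E n ** \<gamma> (n + 1) = 0"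
proof -
  \<comment> \<open>This stands for P_{n-1}; the case n = 0 is separate because \<open>n - 1\<close>
    would truncate to 0.\<close>
  define a' where "a' = (if n = 0 then \<lambda>_. 0 else a (n - 1))"
  have rec: "prev (a n) = (\<lambda>j. a (n + 1) j + \<beta> n ** a n j + \<gamma> n ** a' j)"
    using recurrence[of n] by (cases n) (auto simp: a'_def fun_eq_iff gamma_0 matrix_simps)
  have rec': "prev (a m) j = a (m + 1) j + \<beta> m ** a m j + \<gamma> m ** a (m - 1) j" if "m > 0" for m j
    using recurrence[of m j] that by (cases m) auto
  have op_a': "\<gamma> n ** pearson_op a' j = \<gamma> n ** (C ** a (n + 1) j + E (n - 1) ** a n j - (of_nat n - 1) *\<^sub>m a' j)" for j
    using structure_relation[of "n - 1" j]
    by (cases n) (auto simp: a'_def gamma_0 matrix_simps)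
  have main: "pearson_op (prev (a n)) j = prev (pearson_op (a n)) j + prev (a n) j" for j
    by (rule op_prev)
  have prev_op: "prev (pearson_op (a n)) j = C ** prev (a (n + 2)) j + E n ** prev (a (n + 1)) j - of_nat n *\<^sub>m prev (a n) j" for j
    by (cases j) (simp_all add: structure_relation matrix_simps)
  \<comment> \<open>The terms in P_{n+3} and P_{n-1} cancel, so three coefficients remain. Reading
    off z^(n+2), z^(n+1) and z^n in this order, each time at a leading coefficient, shows that they
    vanish one after the other.\<close>
  have key: "(C ** \<beta> (n+2) + E n - (E (n+1) + \<beta> n ** C)) ** a (n + 2) j
     + (C ** \<gamma> (n+2) + E n ** \<beta> (n+1) - \<beta> n ** E n - \<gamma> n ** C + 2 *\<^sub>m mat 1) ** a (n + 1) j
     + (E n ** \<gamma> (n+1) + \<beta> n - \<gamma> n ** E (n - 1)) ** a n j = 0" for j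
    using main[of j] unfolding prev_op unfolding rec op_linear op_a' structure_relation
    by (simp add: rec' matrix_mult_simps cscale_mult_left cscale_mult_right, simp add: cscale_simps algebra_simps)
  have 2: "C ** \<beta> (n+2) + E n - (E (n+1) + \<beta> n ** C) = 0"
    using key[of "n + 2"] by (simp add: coeff_lead coeff_degree matrix_mult_simps(7))
  have 1: "C ** \<gamma> (n+2) + E n ** \<beta> (n+1) - \<beta> n ** E n - \<gamma> n ** C + 2 *\<^sub>m mat 1 = 0"
    using key[of "n + 1"] unfolding 2
    by (simp add: coeff_lead coeff_degree matrix_mult_simps(7,8))
  have "E n ** \<gamma> (n+1) + \<beta> n - \<gamma> n ** E (n - 1) = 0"
    using key[of n] unfolding 1 2 by (simp add: coeff_lead matrix_mult_simps(8))
  then show ?thesis by (simp add: algebra_simps)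
qed

text \<open>Writing each \<open>E m\<close> through \<beta> and a commutator gives the claim. The
  commutator next to \<open>\<gamma> n\<close> comes from \<open>E (n - 1)\<close>, so its sum stops
  before n - 1; for n = 0 the truncated index is harmless since
  \<open>\<gamma> 0 = 0\<close>.\<close>

lemma second_equation:
  "\<beta> n - \<gamma> n ** (C ** (\<beta> n + prev \<beta> n)) + (C ** (\<beta> n + \<beta> (n + 1))) ** \<gamma> (n + 1) =
    - (\<gamma> n ** commutator (\<Sum>k<n - 1. \<beta> k) C) + commutator (\<Sum>k<n. \<beta> k) C ** \<gamma> (n + 1)"
proof -
  have E: "E m = C ** (\<beta> m + \<beta> (m + 1)) - commutator (\<Sum>k<m. \<beta> k) C" for m
    by (simp add: E_def p1_Suc p1_eq commutator_def matrix_simps)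
  show ?thesis
  proof (cases n)
    case 0
    then show ?thesis
      using second_equation_E[of n] unfolding E by (simp add: gamma_0 matrix_simps algebra_simps)
  next
    case (Suc m)
    then show ?thesis
      using second_equation_E[of n] unfolding E by (simp add: matrix_simps algebra_simps)
  qed
qed

section \<open>Nonsingularity of C\<close>

lemma M_0: "M 0 = G 0"
  using orthogonality[of 0 0] by (simp add: coeff_lead)

text \<open>If X C = 0, the moment recursion loses its last term. At k = 0 it gives X A = - X, hence
  X M_1 = X M_2 = 0. Orthogonality of P_1 to 1 then yields X \<open>a 1 0\<close> = 0, so X
  \<open>G 1\<close> = 0. The dPIV equation inverts C \<gamma>_{n+1}, which requires this.\<close>

lemma invertible_C: "invertible C"
proof (rule invertible_if_left_mult_eq_0)
  fix X :: "complex ^ 'n ^ 'n" assume X: "X ** C = 0"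
  have rec: "of_nat (k + 1) *\<^sub>m (X ** M k) + X ** (A ** M k) = 0" for k
  proof -
    have "X ** (of_nat (k + 1) *\<^sub>m M k + A ** M k + C ** M (k + 2)) = 0"
      by (simp only: moment_recursion matrix_simps)
    moreover have "X ** (C ** M (k + 2)) = 0"
      by (simp add: matrix_mul_assoc X matrix_mult_simps(8))
    ultimately show ?thesis by (simp add: matrix_mult_simps cscale_mult_right)
  qed
  have "(X + X ** A) ** G 0 = 0"
    using rec[of 0] by (simp add: M_0 matrix_simps)
  then have "X + X ** A = 0"
    by (rule invertible_cancel_right[OF invertible_G])
  then have XA: "X ** A = - X"
    by (simp add: add_eq_0_iff)
  have XM: "of_nat k *\<^sub>m (X ** M k) = 0" for k
    using rec[of k] by (simp add: matrix_mul_assoc XA matrix_mult_distribs cscale_simps)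
  have "X ** M 1 = 0" "X ** M 2 = 0"
    using XM[of 1] XM[of 2] by (simp_all add: cscale_eq_0)
  have o: "a 1 0 ** M 0 + M 1 = 0" "a 1 0 ** M 1 + M 2 = G 1"
    using orthogonality[of 0 1] orthogonality[of 1 1] by (simp_all add: coeff_lead numeral_2_eq_2)
  have "X ** (a 1 0 ** M 0 + M 1) = 0"
    unfolding o by (simp add: matrix_mult_simps)
  then have "(X ** a 1 0) ** G 0 = 0"
    using \<open>X ** M 1 = 0\<close> by (simp add: M_0 matrix_mult_simps)
  then have "X ** a 1 0 = 0"
    by (rule invertible_cancel_right[OF invertible_G])
  moreover have "X ** G 1 = (X ** a 1 0) ** M 1 + X ** M 2"
    unfolding o(2)[symmetric] by (simp add: matrix_mult_simps)
  ultimately have "X ** G 1 = 0"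
    using \<open>X ** M 2 = 0\<close> by (simp add: matrix_mult_simps)
  then show "X = 0"
    by (rule invertible_cancel_right[OF invertible_G])
qed

section \<open>Commutation of the recursion coefficients\<close>

definition commutant :: "(complex ^ 'n ^ 'n) set"
  where "commutant = {X. X ** A = A ** X \<and> X ** C = C ** X}"

text \<open>The matrix \<open>K\<close> normalizes the moments on the right, which does not affect
  left orthogonality, and the normalized moments commute with X. So X P_n - P_n X has degree below n
  and is orthogonal to all lower powers.\<close>

lemma commutant_coeff:
  assumes K: "invertible K"
    and moments: "\<And>X k. X \<in> commutant \<Longrightarrow> X ** (M k ** K) = M k ** (K ** X)"
    and X: "X \<in> commutant"
  shows "X ** a n j = a n j ** X"
proof -
  define q where "q = (\<lambda>j. X ** a n j - a n j ** X)"
  have "q j = 0"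
  proof (rule orthogonal_unique)
    fix j assume "n \<le> j"
    then show "q j = 0"
      by (cases "j = n") (auto simp: q_def coeff_lead coeff_degree matrix_simps)
  next
    show "n \<le> n + 1" by simp
    fix k assume k: "k < n"
    have 0: "pairing (n + 1) (a n) k = 0"
      using k by (simp add: pairing_coeff)
    have "pairing (n + 1) q k ** K
        = X ** (pairing (n + 1) (a n) k ** K) - pairing (n + 1) (a n) k ** (K ** X)"
      unfolding pairing_def q_def matrix_mult_sum_left matrix_mult_sum_right sum_subtractf[symmetric]
      by (rule sum.cong) (simp_all add: matrix_mult_simps moments[OF X])
    also have "\<dots> = 0"
      unfolding 0 by (simp add: matrix_mult_simps)
    finally show "pairing (n + 1) q k = 0"
      by (rule invertible_cancel_right[OF K])
  qed
  then show ?thesis by (simp add: q_def)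
qed

lemma commutant_recursion_coeffs:
  assumes "invertible K"
    and "\<And>X k. X \<in> commutant \<Longrightarrow> X ** (M k ** K) = M k ** (K ** X)"
    and "X \<in> commutant"
  shows "X ** \<beta> n = \<beta> n ** X" "X ** \<gamma> n = \<gamma> n ** X"
proof -
  have p1: "X ** p1 m = p1 m ** X" for m
    using commutant_coeff[OF assms] by (cases m) (auto simp: p1_def matrix_simps)
  have "prev (prev (a m)) k ** X = X ** prev (prev (a m)) k" for m k
    using commutant_coeff[OF assms] by (auto simp: prev_def matrix_simps split: nat.split)
  then have p2: "X ** p2 m = p2 m ** X" for m
    by (simp add: p2_def)
  have b: "\<beta> m = p1 m - p1 (Suc m)" for m
    by (simp add: p1_Suc)
  show beta: "X ** \<beta> n = \<beta> n ** X" for n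
    by (simp add: b p1 matrix_simps)
  have "\<gamma> n = p2 n - \<beta> n ** p1 n - p2 (Suc n)"
    by (simp add: p2_Suc)
  moreover have "X ** (\<beta> n ** p1 n) = \<beta> n ** (p1 n ** X)"
    by (metis beta p1 matrix_mul_assoc)
  ultimately show "X ** \<gamma> n = \<gamma> n ** X"
    by (simp add: p2 matrix_simps)
qed

lemma abelian_recursion_coeffs:
  assumes K: "invertible K"
    and moments: "\<And>X k. X \<in> commutant \<Longrightarrow> X ** (M k ** K) = M k ** (K ** X)"
    and AC: "A ** C = C ** A"
  shows "abelian_set ({A, C} \<union> range \<beta> \<union> range \<gamma>)"
proof -
  have coeffs: "X ** \<beta> n = \<beta> n ** X" "X ** \<gamma> n = \<gamma> n ** X" if "X \<in> commutant" for X n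
    using commutant_recursion_coeffs[OF K _ that] moments by blast+
  have A: "A \<in> commutant" and C: "C \<in> commutant" using AC by (auto simp: commutant_def)
  \<comment> \<open>First use of \<open>coeffs\<close>, with A and C. Membership in the commutant
    then allows \<open>coeffs\<close> to be applied in \<open>comm\<close> to the recursion
    coefficients themselves.\<close>
  have \<beta>: "\<beta> n \<in> commutant" and \<gamma>: "\<gamma> n \<in> commutant" for n
    using coeffs[OF A, of n] coeffs[OF C, of n] by (simp_all add: commutant_def)
  have comm: "X ** Y = Y ** X"
    if X: "X \<in> commutant" and Y: "Y \<in> {A, C} \<union> range \<beta> \<union> range \<gamma>" for X Y
  proof -
    from Y consider "Y = A" | "Y = C" | n where "Y = \<beta> n" | n where "Y = \<gamma> n" by blast
    then show ?thesis
      using X coeffs[OF X] by cases (simp_all add: commutant_def)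
  qed
  have "X \<in> commutant" if "X \<in> {A, C} \<union> range \<beta> \<union> range \<gamma>" for X
    using that A C \<beta> \<gamma> by (elim UnE) auto
  then show ?thesis
    unfolding abelian_set_def using comm by metis
qed

section \<open>Reduction to the discrete Painleve IV equation\<close>

lemma dPIV_if_abelian:
  assumes abelian: "abelian_set ({A, C} \<union> range \<beta> \<union> range \<gamma>)"
    and inv: "\<And>n. invertible (\<gamma> (Suc n))"
  shows "of_nat (2 * n + 1) *\<^sub>m mat 1 + A + C ** (\<gamma> (n + 1) + \<gamma> n) + C ** (\<beta> n ** \<beta> n) = 0"
    and "\<beta> n - \<gamma> n ** (C ** (\<beta> n + prev \<beta> n)) + (C ** (\<beta> n + \<beta> (n + 1))) ** \<gamma> (n + 1) = 0"
    and "dPIV A C \<gamma>"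
proof -
  have comm: "C ** A = A ** C" "\<beta> n ** A = A ** \<beta> n" "\<gamma> n ** A = A ** \<gamma> n"
    "\<beta> n ** C = C ** \<beta> n" "\<gamma> n ** C = C ** \<gamma> n" "\<beta> m ** \<gamma> n = \<gamma> n ** \<beta> m"
    "\<beta> m ** \<beta> n = \<beta> n ** \<beta> m" "\<gamma> m ** \<gamma> n = \<gamma> n ** \<gamma> m" for m n
    by (rule abelian[unfolded abelian_set_def, rule_format]; simp)+
  \<comment> \<open>Left-commutation rules, so that the simplifier can sort products of any
    length.\<close>
  have left: "Y ** (X ** Z) = X ** (Y ** Z)" if "Y ** X = X ** Y" for X Y Z :: "complex ^ 'n ^ 'n"
    using that by (metis matrix_mul_assoc)
  note comm' = comm comm[THEN left]
  have 0: "commutator (\<Sum>k\<in>I. \<beta> k) C = 0" "commutator (\<Sum>k\<in>I. \<gamma> k) C = 0"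
    "commutator (\<Sum>i<n. \<Sum>j<i. \<beta> i ** \<beta> j) C = 0" for I n
    by (simp_all add: commutator_def matrix_mult_sum_left matrix_mult_sum_right matrix_mult_simps comm')
  have 00: "commutator (X - Y) C = commutator X C - commutator Y C" for X Y
    by (simp add: commutator_def matrix_mult_simps)
  show first: "of_nat (2 * n + 1) *\<^sub>m mat 1 + A + C ** (\<gamma> (n + 1) + \<gamma> n) + C ** (\<beta> n ** \<beta> n) = 0" for n
    by (simp only: first_equation 0 00) (simp add: matrix_mult_simps)
  show second: "\<beta> n - \<gamma> n ** (C ** (\<beta> n + prev \<beta> n)) + (C ** (\<beta> n + \<beta> (n + 1))) ** \<gamma> (n + 1) = 0" for n
    by (simp only: second_equation 0) (simp add: matrix_mult_simps)
  let ?x = "xi A C \<gamma>"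
  have half: "(1 / 2) *\<^sub>m A + (1 / 2) *\<^sub>m A = A"
    by (simp add: cscale_add_left[symmetric] cscale_one)
  have xi_sum: "?x n + ?x (Suc n) = - (C ** (\<beta> n ** \<beta> n))" for n
  proof -
    have "?x n + ?x (Suc n) = of_nat (2 * n + 1) *\<^sub>m mat 1 + A + C ** (\<gamma> (n + 1) + \<gamma> n)"
      unfolding xi_def mat_eq_cscale[of "of_nat _"]
      by (subst (3) half[symmetric]) (simp add: matrix_simps)
    then show ?thesis using first[of n] by (simp add: add_eq_0_iff2)
  qed
  have prev_comm: "prev \<beta> n ** X = X ** prev \<beta> n" if "X = C \<or> X = \<gamma> m \<or> X = \<beta> m" for n m X
    using that by (cases n) (auto simp: comm matrix_mult_simps)
  have prev_comm': "C ** prev \<beta> n = prev \<beta> n ** C" "\<gamma> m ** prev \<beta> n = prev \<beta> n ** \<gamma> m"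
     "\<beta> m ** prev \<beta> n = prev \<beta> n ** \<beta> m" for n m
    using prev_comm by metis+
  \<comment> \<open>Telescoping sum; it starts at zero because
    \<open>prev \<beta> 0 = 0\<close>.\<close>
  have xi_sq: "?x n ** ?x n - ?x 0 ** ?x 0 = C ** (C ** (\<gamma> n ** (\<beta> n ** prev \<beta> n)))" for n
  proof (induction n)
    case 0
    then show ?case by (simp add: matrix_mult_simps)
  next
    case (Suc n)
    have "?x (Suc n) ** ?x n = ?x n ** ?x (Suc n)"
      by (simp add: xi_def mat_eq_cscale[of "of_nat _"] mat_eq_cscale[of "1 + of_nat _"] matrix_simps comm')
    then have "?x (Suc n) ** ?x (Suc n) - ?x n ** ?x n = (?x n + ?x (Suc n)) ** (?x (Suc n) - ?x n)"
      by (simp add: matrix_mult_simps)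
    also have "?x (Suc n) - ?x n = mat 1 + C ** \<gamma> (Suc n) - C ** \<gamma> n"
      by (simp add: xi_def mat_eq_cscale[of "of_nat _"] mat_eq_cscale[of "1 + of_nat _"] cscale_simps)
    \<comment> \<open>The last summand is - C \<beta>_n times the left-hand side of the second
      equation, displayed in this form so that \<open>second\<close> removes it.\<close>
    also have "(?x n + ?x (Suc n)) ** \<dots> = C ** (C ** (\<gamma> (Suc n) ** (\<beta> (Suc n) ** \<beta> n)))
        - C ** (C ** (\<gamma> n ** (\<beta> n ** prev \<beta> n)))
       - C ** (\<beta> n ** (\<beta> n - \<gamma> n ** (C ** (\<beta> n + prev \<beta> n)) + (C ** (\<beta> n + \<beta> (n + 1))) ** \<gamma> (n + 1)))"
      unfolding xi_sum by (simp add: matrix_mult_simps comm' algebra_simps)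
    finally show ?case using Suc.IH unfolding second by (simp add: matrix_mult_simps algebra_simps)
  qed
  show "dPIV A C \<gamma>"
    unfolding dPIV_def Let_def
  proof (intro allI conjI)
    fix n
    let ?D = "?x (n + 1) - (1 / 2) *\<^sub>m A - mat (of_nat (n + 1))"
    have D: "?D = C ** \<gamma> (Suc n)"
      by (simp add: xi_def)
    show "invertible ?D"
      unfolding D using inv invertible_C by (rule_tac invertible_mult)
    then have "matrix_inv ?D ** (?D ** X) = X" for X
      by (simp add: matrix_mul_assoc invertible_matrix_inv_mult)
    moreover have "?x (n + 1) ** ?x (n + 1) - ?x 0 ** ?x 0 = ?D ** (C ** (\<beta> (n + 1) ** \<beta> n))"
      unfolding xi_sq D by (simp add: matrix_mult_simps comm')
    ultimately have R: "matrix_inv ?D ** (?x (n + 1) ** ?x (n + 1) - ?x 0 ** ?x 0)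
        = C ** (\<beta> (n + 1) ** \<beta> n)"
      by simp
    \<comment> \<open>By \<open>xi_sum\<close> and \<open>R\<close> both sides equal C^2 \<beta>_n^2
      \<beta>_{n+1}^2.\<close>
    show "(?x n + ?x (n + 1)) ** (?x (n + 1) + ?x (n + 2)) =
        (matrix_inv ?D ** (?x (n + 1) ** ?x (n + 1) - ?x 0 ** ?x 0)) **
        (matrix_inv ?D ** (?x (n + 1) ** ?x (n + 1) - ?x 0 ** ?x 0))"
      unfolding R using xi_sum[of n] xi_sum[of "n + 1"]
      by (simp add: matrix_mult_simps comm')
  qed
qed

end

subsection \<open>Improper integrals and linear differential equations\<close>

text \<open>The gauge integral is approximated on every box containing a large ball; the box from -
  T to T meets the half-line in \<open>{0..T}\<close>.\<close>

lemma tendsto_integral_atLeast: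
  fixes f :: "real \<Rightarrow> 'a::euclidean_space"
  assumes "f integrable_on {0..}"
  shows "((\<lambda>T. integral {0..T} f) \<longlongrightarrow> integral {0..} f) at_top"
proof (rule tendstoI)
  fix e :: real assume "e > 0"
  obtain B where "B > 0" and B: "\<And>a b. ball 0 B \<subseteq> cbox a b \<Longrightarrow>
      norm (integral (cbox a b) (\<lambda>x. if x \<in> {0..} then f x else 0) - integral {0..} f) < e"
    using integrable_integral[OF assms] \<open>e > 0\<close> unfolding has_integral_alt' by blast
  show "\<forall>\<^sub>F T in at_top. dist (integral {0..T} f) (integral {0..} f) < e"
    using eventually_ge_at_top[of B]
  proof eventually_elim
    case (elim T)
    have "integral (cbox (- T) T) (\<lambda>x. if x \<in> {0..} then f x else 0) = integral ({0..} \<inter> cbox (- T) T) f"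
      by (rule integral_restrict_Int)
    also have "{0..} \<inter> cbox (- T) T = {0..T}" by auto
    finally show ?case
      using B[of "- T" T] elim by (force simp: dist_norm)
  qed
qed

text \<open>On t > 0, F differs from the indefinite integral of f by a constant, and that integral
  is continuous at 0 and converges at infinity. The constant is fixed at t = 1, since F is
  controlled only away from 0.\<close>

lemma antiderivative_limits:
  fixes F f :: "real \<Rightarrow> 'a::euclidean_space"
  assumes deriv: "\<And>t. t > 0 \<Longrightarrow> (F has_vector_derivative f t) (at t)"
    and int: "f integrable_on {0..}"
  obtains l where "(F \<longlongrightarrow> l) (at_right 0)" "(F \<longlongrightarrow> l + integral {0..} f) at_top"
proof -
  have int': "f integrable_on {a..b}" if "a \<ge> 0" for a b
    by (rule integrable_on_subinterval[OF int]) (use that in auto)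
  define l where "l = F 1 - integral {0..1} f"
  have F: "F t = l + integral {0..t} f" if "t > 0" for t
  proof -
    have ftc: "integral {a..b} f = F b - F a" if "0 < a" "a \<le> b" for a b
      by (rule integral_unique, rule fundamental_theorem_of_calculus)
        (use that deriv in \<open>auto intro: has_vector_derivative_at_within\<close>)
    show ?thesis
    proof (cases "t \<le> 1")
      case True
      have "integral {0..1} f = integral {0..t} f + integral {t..1} f"
        by (rule Henstock_Kurzweil_Integration.integral_combine[symmetric])
          (use that True int' in auto)
      then show ?thesis
        using ftc[of t 1] that True by (simp add: l_def)
    next
      case False
      have "integral {0..t} f = integral {0..1} f + integral {1..t} f"
        by (rule Henstock_Kurzweil_Integration.integral_combine[symmetric])
          (use that False int' in auto)
      then show ?thesis
        using ftc[of 1 t] that False by (simp add: l_def)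
    qed
  qed
  have "continuous_on {0..1} (\<lambda>t. integral {0..t} f)"
    by (rule indefinite_integral_continuous_1) (rule int', simp)
  then have "((\<lambda>t. integral {0..t} f) \<longlongrightarrow> 0) (at 0 within {0..1})"
    by (auto simp: continuous_on_def dest!: bspec[of _ _ 0])
  then have "((\<lambda>t. l + integral {0..t} f) \<longlongrightarrow> l + 0) (at_right 0)"
    by (intro tendsto_add tendsto_const) (simp add: at_within_Icc_at_right)
  then have 1: "(F \<longlongrightarrow> l) (at_right 0)"
    unfolding add_0_right
    by (rule Lim_transform_eventually) (auto simp: eventually_at_right_field F intro!: exI[of _ 1])
  have "((\<lambda>t. l + integral {0..t} f) \<longlongrightarrow> l + integral {0..} f) at_top"
    by (intro tendsto_add tendsto_const tendsto_integral_atLeast int)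
  then have 2: "(F \<longlongrightarrow> l + integral {0..} f) at_top"
    by (rule Lim_transform_eventually)
      (use F in \<open>auto intro: eventually_mono[OF eventually_gt_at_top[of 0]]\<close>)
  from 1 2 show ?thesis by (rule that)
qed

text \<open>Otherwise \<open>f\<close> would behave like \<open>l / t\<close>, whose integral diverges logarithmically.\<close>

lemma integrable_imp_residue_zero:
  fixes f :: "real \<Rightarrow> 'a::euclidean_space"
  assumes int: "f integrable_on {0..}"
    and lim: "((\<lambda>t. t *\<^sub>R f t) \<longlongrightarrow> l) (at_right 0)"
  shows "l = 0"
proof (rule ccontr)
  assume "l \<noteq> 0"
  define c where "c = l \<bullet> l"
  have "c > 0" using \<open>l \<noteq> 0\<close> by (simp add: c_def)
  define h where "h t = f t \<bullet> l" for t
  have "((\<lambda>t. (t *\<^sub>R f t) \<bullet> l) \<longlongrightarrow> c) (at_right 0)"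
    unfolding c_def by (intro tendsto_inner lim tendsto_const)
  then have "\<forall>\<^sub>F t in at_right 0. (t *\<^sub>R f t) \<bullet> l > c / 2"
    by (rule order_tendstoD) (use \<open>c > 0\<close> in simp)
  then obtain d where d: "d > 0" "\<And>t. 0 < t \<Longrightarrow> t < d \<Longrightarrow> t * h t > c / 2"
    unfolding eventually_at_right_field by (auto simp: h_def)
  define b where "b = d / 2"
  have b: "b > 0" "b < d" using d by (auto simp: b_def)
  have hint: "h integrable_on {x..b}" if "x \<ge> 0" for x
  proof -
    have "f integrable_on {x..b}"
      by (rule integrable_on_subinterval[OF int]) (use that in auto)
    from integrable_linear[OF this bounded_linear_inner_left[of l]]
    show ?thesis by (simp add: h_def[abs_def] o_def)
  qed
  have lower: "c / 2 * (ln b - ln x) \<le> integral {x..b} h" if "0 < x" "x \<le> b" for x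
  proof (rule has_integral_le)
    have "((\<lambda>t. c / 2 * ln t) has_vector_derivative c / 2 * (1 / t)) (at t within {x..b})"
      if "t \<in> {x..b}" for t
      using that \<open>0 < x\<close>
      by (auto simp: has_real_derivative_iff_has_vector_derivative[symmetric]
          intro!: derivative_eq_intros)
    from fundamental_theorem_of_calculus[OF \<open>x \<le> b\<close> this]
    show "((\<lambda>t. c / 2 * (1 / t)) has_integral c / 2 * (ln b - ln x)) {x..b}"
      by (simp add: right_diff_distrib)
    show "(h has_integral integral {x..b} h) {x..b}"
      using hint[of x] that by (simp add: integrable_integral)
    show "c / 2 * (1 / t) \<le> h t" if "t \<in> {x..b}" for t
      using d(2)[of t] that \<open>0 < x\<close> b by (simp add: field_simps)
  qed
  have "continuous_on {0..b} (\<lambda>x. integral {x..b} h)"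
    by (rule indefinite_integral_continuous_1') (rule hint, simp)
  then have "bounded ((\<lambda>x. integral {x..b} h) ` {0..b})"
    by (intro compact_imp_bounded compact_continuous_image) auto
  then obtain B where B: "\<And>x. x \<in> {0..b} \<Longrightarrow> \<bar>integral {x..b} h\<bar> \<le> B"
    unfolding bounded_iff real_norm_def by blast
  \<comment> \<open>Chosen so that the logarithmic lower bound equals B + 1, above the bound
    B.\<close>
  define x where "x = b * exp (- (2 * (B + 1) / c))"
  have "B \<ge> 0" using B[of b] b by fastforce
  have "0 < x" "x \<le> b"
    using b \<open>c > 0\<close> \<open>B \<ge> 0\<close> by (auto simp: x_def mult_le_cancel_left1)
  then have "c / 2 * (ln b - ln x) \<le> B"
    using lower[of x] B[of x] by simp
  moreover have "ln b - ln x = 2 * (B + 1) / c"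
    using b by (simp add: x_def ln_mult)
  ultimately show False using \<open>c > 0\<close> by (simp add: field_simps)
qed

section \<open>Uniqueness for linear differential equations\<close>

text \<open>The squared norm \<phi> satisfies |\<phi>'| \<le> 2 K \<phi>. Hence exp(- 2 K s) \<phi>
  decreases, which handles t after t0, and exp(2 K s) \<phi> increases, which handles t before
  t0.\<close>

lemma gronwall_zero:
  fixes Y D :: "real \<Rightarrow> 'a::real_inner"
  assumes deriv: "\<And>t. t \<in> {a..b} \<Longrightarrow> (Y has_vector_derivative D t) (at t)"
    and bound: "\<And>t. t \<in> {a..b} \<Longrightarrow> norm (D t) \<le> K * norm (Y t)"
    and t0: "t0 \<in> {a..b}" "Y t0 = 0" and t: "t \<in> {a..b}"
  shows "Y t = 0"
proof -
  define \<phi> where "\<phi> s = Y s \<bullet> Y s" for s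
  have \<phi>: "(\<phi> has_real_derivative 2 * (Y s \<bullet> D s)) (at s)" if "s \<in> {a..b}" for s
    unfolding \<phi>_def[abs_def] has_field_derivative_def
    using has_derivative_inner[OF deriv[OF that, unfolded has_vector_derivative_def]
        deriv[OF that, unfolded has_vector_derivative_def]]
    by (simp add: inner_commute mult_commute_abs algebra_simps)
  have b: "\<bar>2 * (Y s \<bullet> D s)\<bar> \<le> 2 * K * \<phi> s" if "s \<in> {a..b}" for s
  proof -
    have "\<bar>Y s \<bullet> D s\<bar> \<le> norm (Y s) * norm (D s)" by (rule Cauchy_Schwarz_ineq2)
    also have "\<dots> \<le> norm (Y s) * (K * norm (Y s))"
      by (intro mult_left_mono bound that) simp
    also have "\<dots> = K * \<phi> s" by (simp add: \<phi>_def dot_square_norm power2_eq_square)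
    finally show ?thesis by simp
  qed
  have weighted: "((\<lambda>s. exp (c * s) * \<phi> s) has_real_derivative
      exp (c * s) * (c * \<phi> s + 2 * (Y s \<bullet> D s))) (at s)" if "s \<in> {a..b}" for s c
    by (rule derivative_eq_intros \<phi>[OF that] refl | simp add: algebra_simps)+
  have "\<phi> t \<le> 0"
  proof (cases "t0 \<le> t")
    case True
    have "exp (- 2 * K * t) * \<phi> t \<le> exp (- 2 * K * t0) * \<phi> t0"
    proof (rule DERIV_nonpos_imp_nonincreasing[OF True])
      fix s assume "t0 \<le> s" "s \<le> t"
      then have s: "s \<in> {a..b}" using t0 t by auto
      show "\<exists>y. ((\<lambda>s. exp (- 2 * K * s) * \<phi> s) has_real_derivative y) (at s) \<and> y \<le> 0"
        using weighted[OF s, of "- 2 * K"] b[OF s]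
        by (intro exI conjI) (auto intro!: mult_nonneg_nonpos)
    qed
    then show ?thesis using t0 by (simp add: \<phi>_def mult_le_0_iff)
  next
    case False
    then have "t \<le> t0" by simp
    have "exp (2 * K * t) * \<phi> t \<le> exp (2 * K * t0) * \<phi> t0"
    proof (rule DERIV_nonneg_imp_nondecreasing[OF \<open>t \<le> t0\<close>])
      fix s assume "t \<le> s" "s \<le> t0"
      then have s: "s \<in> {a..b}" using t0 t by auto
      show "\<exists>y. ((\<lambda>s. exp (2 * K * s) * \<phi> s) has_real_derivative y) (at s) \<and> y \<ge> 0"
        using weighted[OF s, of "2 * K"] b[OF s]
        by (intro exI conjI) (auto intro!: mult_nonneg_nonneg)
    qed
    then show ?thesis using t0 by (simp add: \<phi>_def mult_le_0_iff)
  qed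
  then show ?thesis by (metis \<phi>_def inner_gt_zero_iff not_le)
qed

lemma scaleR_eq_cscale: "r *\<^sub>R (X :: complex ^ 'n ^ 'n) = of_real r *\<^sub>m X"
  unfolding cscale_def by (simp add: vec_eq_iff scaleR_conv_of_real[of r "_ :: complex"])

lemma bounded_linear_matrix_mult_left: "bounded_linear (\<lambda>Y. (X :: complex ^ 'n ^ 'n) ** (Y :: complex ^ 'n ^ 'n))"
  unfolding linear_conv_bounded_linear[symmetric]
  by (rule linearI)
    (simp_all add: matrix_mult_simps scaleR_eq_cscale cscale_simps)

lemma bounded_linear_matrix_mult_right: "bounded_linear (\<lambda>X. (X :: complex ^ 'n ^ 'n) ** (Y :: complex ^ 'n ^ 'n))"
  unfolding linear_conv_bounded_linear[symmetric]
  by (rule linearI)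
    (simp_all add: matrix_mult_simps scaleR_eq_cscale cscale_simps)

lemma bounded_bilinear_matrix_mult: "bounded_bilinear ((**) :: complex ^ 'n ^ 'n \<Rightarrow> _ \<Rightarrow> complex ^ 'n ^ 'n)"
  unfolding bilinear_conv_bounded_bilinear[symmetric] bilinear_def
  using bounded_linear_matrix_mult_left bounded_linear_matrix_mult_right
  by (auto simp: linear_conv_bounded_linear)

lemma bounded_linear_cscale: "bounded_linear (\<lambda>X :: complex ^ 'n ^ 'n. c *\<^sub>m X)"
  unfolding linear_conv_bounded_linear[symmetric]
  by (rule linearI) (simp_all add: scaleR_eq_cscale cscale_simps mult.commute)

lemma tendsto_cscale:
  fixes X :: "'a \<Rightarrow> complex ^ 'n ^ 'n"
  assumes "(c \<longlongrightarrow> c0) F" "(X \<longlongrightarrow> X0) F"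
  shows "((\<lambda>x. c x *\<^sub>m X x) \<longlongrightarrow> c0 *\<^sub>m X0) F"
  unfolding cscale_def by (intro tendsto_intros assms)

lemma has_vector_derivative_matrix:
  fixes F :: "real \<Rightarrow> complex ^ 'n ^ 'n"
  assumes "\<And>i j. ((\<lambda>t. F t $ i $ j) has_vector_derivative D $ i $ j) (at t within S)"
  shows "(F has_vector_derivative D) (at t within S)"
  using assms unfolding has_vector_derivative_def has_derivative_def
  by (intro conjI bounded_linear_scaleR_left vec_tendstoI) simp

text \<open>N may be singular at 0, but it is bounded on the compact interval between t and u, where
  the Gronwall estimate applies.\<close>

lemma linear_matrix_ode_unique:
  fixes Y N :: "real \<Rightarrow> complex ^ 'n ^ 'n"
  assumes deriv: "\<And>t. t > 0 \<Longrightarrow> (Y has_vector_derivative N t ** Y t) (at t)"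
    and cont: "continuous_on {0<..} N"
    and "u > 0" "Y u = 0" "t > 0"
  shows "Y t = 0"
proof -
  from bounded_bilinear.pos_bounded[OF bounded_bilinear_matrix_mult]
  obtain B where "B > 0"
    and "\<forall>X Z. norm ((X :: complex ^ 'n ^ 'n) ** (Z :: complex ^ 'n ^ 'n)) \<le> norm X * norm Z * B"
    by (elim exE conjE)
  then have B: "norm (X ** Z) \<le> norm X * norm Z * B" for X Z :: "complex ^ 'n ^ 'n"
    by simp
  define a b where "a = min t u" and "b = max t u"
  have "continuous_on {a..b} N"
    by (rule continuous_on_subset[OF cont]) (use assms in \<open>auto simp: a_def\<close>)
  then have "bounded (N ` {a..b})"
    by (intro compact_imp_bounded compact_continuous_image) auto
  then obtain R where R: "\<And>s. s \<in> {a..b} \<Longrightarrow> norm (N s) \<le> R"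
    unfolding bounded_iff by blast
  show ?thesis
  proof (rule gronwall_zero[where a = a and b = b and K = "R * B"])
    fix s assume s: "s \<in> {a..b}"
    then have "s > 0" using assms by (auto simp: a_def)
    then show "(Y has_vector_derivative N s ** Y s) (at s)" by (rule deriv)
    have "norm (N s ** Y s) \<le> norm (N s) * norm (Y s) * B" by (rule B)
    also have "\<dots> \<le> R * norm (Y s) * B"
      using R[OF s] \<open>B > 0\<close> by (intro mult_right_mono) auto
    finally show "norm (N s ** Y s) \<le> R * B * norm (Y s)" by (simp add: mult_ac)
  qed (use assms in \<open>auto simp: a_def b_def\<close>)
qed

lemma matrix_poly_eq_coeffs:
  fixes p q :: "nat \<Rightarrow> complex ^ 'n ^ 'n"
  assumes "\<And>z. (\<Sum>k\<le>n. z ^ k *\<^sub>m p k) = (\<Sum>k\<le>n. z ^ k *\<^sub>m q k)" "k \<le> n"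
  shows "p k = q k"
proof -
  have "p k $ i $ j = q k $ i $ j" for i j
  proof -
    have "(\<Sum>k\<le>n. p k $ i $ j * z ^ k) = (\<Sum>k\<le>n. q k $ i $ j * z ^ k)" for z
      using arg_cong[OF assms(1)[of z], of "\<lambda>X. X $ i $ j"] by (simp add: cscale_def mult.commute)
    then show ?thesis
      using assms(2) polyfun_eq_coeffs[of "\<lambda>k. p k $ i $ j" n "\<lambda>k. q k $ i $ j"] by blast
  qed
  then show ?thesis by (simp add: vec_eq_iff)
qed

subsection \<open>Moments of a weight satisfying the Pearson equation\<close>

locale pearson_weight =
  fixes g :: "real \<Rightarrow> complex"
    and W :: "complex \<Rightarrow> complex ^ 'n ^ 'n"
    and A C :: "complex ^ 'n ^ 'n"
  assumes curve: "laguerre_curve g"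
    and pearson: "pearson_equation g W A 0 C"
    and integrable: "curve_integrable g (\<lambda>z. z ^ k *\<^sub>m W z)"
begin

section \<open>The parametrized weight\<close>

definition speed :: "real \<Rightarrow> complex"
  where "speed t = vector_derivative g (at t within {0..})"

lemma g_0: "g 0 = 0"
  using curve by (simp add: laguerre_curve_def)

lemma g_nonzero: "t > 0 \<Longrightarrow> g t \<noteq> 0"
  using curve g_0 unfolding laguerre_curve_def
  by (metis atLeast_iff inj_on_def less_eq_real_def less_irrefl)

lemma speed_properties:
  shows speed: "t \<ge> 0 \<Longrightarrow> (g has_vector_derivative speed t) (at t within {0..})"
    and speed_nonzero: "t \<ge> 0 \<Longrightarrow> speed t \<noteq> 0"
    and speed_continuous: "continuous_on {0..} speed"
proof -
  obtain g' where g': "continuous_on {0..} g'"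
      "\<forall>t\<in>{0..}. (g has_vector_derivative g' t) (at t within {0..}) \<and> g' t \<noteq> 0"
    using curve unfolding laguerre_curve_def by blast
  \<comment> \<open>Needed for \<open>vector_derivative\<close> to be the unique derivative,
    including the one-sided one at 0.\<close>
  have nontrivial: "at t within {0..} \<noteq> bot" if "t \<ge> 0" for t :: real
  proof
    assume "at t within {0..} = bot"
    moreover have "at_right t \<le> at t within {0..}"
      by (rule at_le) (use that in auto)
    ultimately show False
      using trivial_limit_at_right_real[of t] by (simp add: bot_unique)
  qed
  have eq: "speed t = g' t" if "t \<ge> 0" for t
    unfolding speed_def by (rule vector_derivative_within[OF nontrivial[OF that]]) (use g' that in auto)
  show "t \<ge> 0 \<Longrightarrow> (g has_vector_derivative speed t) (at t within {0..})"
    "t \<ge> 0 \<Longrightarrow> speed t \<noteq> 0"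
    using g' by (simp_all add: eq)
  have "continuous_on {0..} speed = continuous_on {0..} g'"
    by (rule continuous_on_cong) (simp_all add: eq)
  then show "continuous_on {0..} speed"
    using g' by simp
qed

lemma speed_at: "t > 0 \<Longrightarrow> (g has_vector_derivative speed t) (at t)"
proof -
  assume "t > 0"
  then have "(g has_vector_derivative speed t) (at t within {0<..})"
    by (intro has_vector_derivative_within_subset[OF speed]) auto
  then show ?thesis
    using \<open>t > 0\<close> by (simp add: at_within_open[of t "{0<..}"])
qed

lemma continuous_on_g: "continuous_on {0..} g"
  using speed by (auto intro!: has_vector_derivative_continuous simp: continuous_on_eq_continuous_within)

lemma W_deriv:
  assumes "t > 0"
  obtains W' where
    "\<And>i j. ((\<lambda>t. W (g t) $ i $ j) has_vector_derivative speed t * W' $ i $ j) (at t)"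
    "g t *\<^sub>m W' = (A + g t ^ 2 *\<^sub>m C) ** W (g t)"
proof -
  have "g t \<in> g ` {0<..}" using assms by auto
  then obtain W' where
    d: "\<And>i j. ((\<lambda>x. W x $ i $ j) has_field_derivative W' $ i $ j) (at (g t) within g ` {0<..})" and
    W': "g t *\<^sub>m W' = (A + g t *\<^sub>m 0 + g t ^ 2 *\<^sub>m C) ** W (g t)"
    using pearson unfolding pearson_equation_def by meson
  have "((\<lambda>t. W (g t) $ i $ j) has_vector_derivative speed t * W' $ i $ j) (at t)" for i j
  proof -
    have "(g has_vector_derivative speed t) (at t within {0<..})"
      by (rule has_vector_derivative_at_within[OF speed_at[OF assms]])
    from field_vector_diff_chain_within[OF this d]
    show ?thesis
      using assms by (simp add: at_within_open[of t "{0<..}"] o_def)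
  qed
  with W' show ?thesis
    by (intro that) (simp_all add: cscale_zero_right)
qed

lemma W_ode:
  assumes "t > 0"
  shows "((\<lambda>t. W (g t)) has_vector_derivative
    ((speed t / g t) *\<^sub>m (A + g t ^ 2 *\<^sub>m C)) ** W (g t)) (at t)"
proof -
  obtain W' where
    d: "\<And>i j. ((\<lambda>t. W (g t) $ i $ j) has_vector_derivative speed t * W' $ i $ j) (at t)" and
    W': "g t *\<^sub>m W' = (A + g t ^ 2 *\<^sub>m C) ** W (g t)"
    using W_deriv[OF assms] by blast
  have "((speed t / g t) *\<^sub>m (A + g t ^ 2 *\<^sub>m C)) ** W (g t) = speed t *\<^sub>m W'"
    unfolding cscale_mult_left W'[symmetric] using g_nonzero[OF assms] by (simp add: cscale_cscale)
  then show ?thesis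
    by (auto intro!: has_vector_derivative_matrix simp: d cscale_def)
qed

lemma continuous_on_ode_coeff:
  "continuous_on {0<..} (\<lambda>t. (speed t / g t) *\<^sub>m (A + g t ^ 2 *\<^sub>m C))"
proof -
  have "continuous_on {0<..} g" "continuous_on {0<..} speed"
    using continuous_on_g speed_continuous by (auto elim: continuous_on_subset)
  then show ?thesis
    unfolding cscale_def by (intro continuous_intros) (auto dest: g_nonzero)
qed

section \<open>Moments as integrals over the parameter\<close>

definition w :: "nat \<Rightarrow> real \<Rightarrow> complex ^ 'n ^ 'n"
  where "w k t = speed t *\<^sub>m g t ^ k *\<^sub>m W (g t)"

text \<open>The k-th moment without its factor 1 / (2 pi i), which is restored when the algebraic
  locale is instantiated.\<close>

definition m :: "nat \<Rightarrow> complex ^ 'n ^ 'n"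
  where "m k = integral {0..} (w k)"

lemma w_has_integral: "(w k has_integral m k) {0..}"
  using integrable[of k] unfolding curve_integrable_def m_def w_def[abs_def] speed_def
  by (rule integrable_integral)

lemma linear_integral_eq:
  assumes "bounded_linear L1" "bounded_linear L2" "\<And>t. t > 0 \<Longrightarrow> L1 (w k t) = L2 (w k t)"
  shows "L1 (m k) = L2 (m k)"
proof -
  have 1: "((\<lambda>t. L1 (w k t)) has_integral L1 (m k)) {0..}"
    using has_integral_linear[OF w_has_integral assms(1)] by (simp add: o_def)
  have "((\<lambda>t. L2 (w k t)) has_integral L2 (m k)) {0..}"
    using has_integral_linear[OF w_has_integral assms(2)] by (simp add: o_def)
  then have "((\<lambda>t. L1 (w k t)) has_integral L2 (m k)) {0..}"
    by (rule has_integral_spike[OF negligible_sing[of 0], rotated]) (use assms(3) in auto)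
  with 1 show ?thesis by (rule has_integral_unique)
qed

definition F :: "nat \<Rightarrow> real \<Rightarrow> complex ^ 'n ^ 'n"
  where "F k t = g t ^ Suc k *\<^sub>m W (g t)"

text \<open>Product rule for z^(k+1) W, with z W' replaced through the Pearson equation.\<close>

lemma F_deriv:
  assumes "t > 0"
  shows "(F k has_vector_derivative of_nat (k + 1) *\<^sub>m w k t + A ** w k t + C ** w (k + 2) t) (at t)"
proof (rule has_vector_derivative_matrix)
  fix i j
  obtain W' where
    d: "\<And>i j. ((\<lambda>t. W (g t) $ i $ j) has_vector_derivative speed t * W' $ i $ j) (at t)" and
    W': "g t *\<^sub>m W' = (A + g t ^ 2 *\<^sub>m C) ** W (g t)"
    using W_deriv[OF assms] by blast
  have "((\<lambda>t. g t ^ Suc k) has_vector_derivative speed t * (of_nat (Suc k) * g t ^ k)) (at t)"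
  proof -
    have "((\<lambda>z. z ^ Suc k) has_field_derivative of_nat (Suc k) * g t ^ k) (at (g t))"
      by (rule DERIV_cong[OF DERIV_power[OF DERIV_ident]]) simp
    from field_vector_diff_chain_at[OF speed_at[OF assms] this] show ?thesis
      by (simp only: o_def)
  qed
  from has_vector_derivative_mult[OF this d]
  have "((\<lambda>t. F k t $ i $ j) has_vector_derivative
      g t ^ Suc k * (speed t * W' $ i $ j) + speed t * (of_nat (Suc k) * g t ^ k) * W (g t) $ i $ j) (at t)"
    by (simp add: F_def cscale_def del: power_Suc of_nat_Suc)
  moreover have "g t ^ Suc k * (speed t * W' $ i $ j) + speed t * (of_nat (Suc k) * g t ^ k) * W (g t) $ i $ j
      = (of_nat (k + 1) *\<^sub>m w k t + speed t *\<^sub>m g t ^ k *\<^sub>m (g t *\<^sub>m W')) $ i $ j"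
    by (simp add: cscale_def w_def)
  moreover have "speed t *\<^sub>m g t ^ k *\<^sub>m (g t *\<^sub>m W') = A ** w k t + C ** w (k + 2) t"
    unfolding W' by (simp add: w_def matrix_simps power_add power2_eq_square mult_ac)
  ultimately show "((\<lambda>t. F k t $ i $ j) has_vector_derivative
      (of_nat (k + 1) *\<^sub>m w k t + A ** w k t + C ** w (k + 2) t) $ i $ j) (at t)"
    by (simp only: add.assoc)
qed

lemma tendsto_inverse_g: "((\<lambda>t. inverse (g t)) \<longlongrightarrow> 0) at_top"
  using curve unfolding laguerre_curve_def by (auto intro: tendsto_inverse_0[THEN filterlim_compose])

text \<open>The left-hand side is the integral of the derivative of \<open>F k\<close>, so it is the
  difference of the limits of \<open>F k\<close> at infinity and at 0, and both limits
  vanish.\<close>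

lemma moment_identity: "of_nat (k + 1) *\<^sub>m m k + A ** m k + C ** m (k + 2) = 0"
proof -
  let ?f = "\<lambda>k t. of_nat (k + 1) *\<^sub>m w k t + A ** w k t + C ** w (k + 2) t"
  have int: "(?f k has_integral of_nat (k + 1) *\<^sub>m m k + A ** m k + C ** m (k + 2)) {0..}" for k
    by (intro has_integral_add
        has_integral_linear[OF w_has_integral bounded_linear_cscale, unfolded o_def]
        has_integral_linear[OF w_has_integral bounded_linear_matrix_mult_left, unfolded o_def])
  have ex: "\<exists>l. (F k \<longlongrightarrow> l) (at_right 0) \<and> (F k \<longlongrightarrow> l + integral {0..} (?f k)) at_top" for k
  proof -
    have "?f k integrable_on {0..}" using int by blast
    from antiderivative_limits[OF F_deriv this] show ?thesis by blast
  qed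
  \<comment> \<open>\<open>F k\<close> is \<open>F (Suc k)\<close> divided by g, where the numerator
    has a finite limit and g tends to infinity.\<close>
  have inf: "(F k \<longlongrightarrow> 0) at_top" for k
  proof -
    obtain l where "(F (Suc k) \<longlongrightarrow> l) at_top" using ex[of "Suc k"] by blast
    from tendsto_cscale[OF tendsto_inverse_g this]
    have "((\<lambda>t. inverse (g t) *\<^sub>m F (Suc k) t) \<longlongrightarrow> 0) at_top"
      by (simp add: cscale_zero_left)
    then show ?thesis
    proof (rule Lim_transform_eventually)
      show "\<forall>\<^sub>F t in at_top. inverse (g t) *\<^sub>m F (Suc k) t = F k t"
        using eventually_gt_at_top[of 0]
        by eventually_elim (simp add: F_def cscale_cscale g_nonzero flip: mult.assoc)
    qed
  qed
  have g0: "(g \<longlongrightarrow> 0) (at_right 0)"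
  proof -
    have "(g \<longlongrightarrow> g 0) (at 0 within {0..})"
      using continuous_on_g by (auto simp: continuous_on_def)
    then show ?thesis
      unfolding g_0 by (rule tendsto_within_subset) auto
  qed
  have zero: "(F k \<longlongrightarrow> 0) (at_right 0)" for k
  proof (cases k)
    case (Suc i)
    obtain l where "(F i \<longlongrightarrow> l) (at_right 0)" using ex by blast
    from tendsto_cscale[OF g0 this] show ?thesis
      by (simp add: Suc F_def[abs_def] cscale_zero_left cscale_cscale)
  next
    case 0
    \<comment> \<open>No lower \<open>F\<close> is available here. Since g(t) / t tends to the
      nonzero \<open>speed 0\<close>, the integrand satisfies t \<open>w 0 t\<close>
      \<longlongrightarrow> l, and integrability forces l = 0.\<close>
    obtain l where l: "(F 0 \<longlongrightarrow> l) (at_right 0)" using ex by blast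
    have "((\<lambda>t. (1 / norm (t - 0)) *\<^sub>R (g t - (g 0 + (t - 0) *\<^sub>R speed 0))) \<longlongrightarrow> 0) (at_right 0)"
      using speed[of 0] unfolding has_vector_derivative_def has_derivative_within
      by (auto intro: tendsto_within_subset)
    then have "((\<lambda>t. speed 0 + (1 / norm (t - 0)) *\<^sub>R (g t - (g 0 + (t - 0) *\<^sub>R speed 0)))
        \<longlongrightarrow> speed 0 + 0) (at_right 0)"
      by (intro tendsto_add tendsto_const)
    then have "((\<lambda>t. g t /\<^sub>R t) \<longlongrightarrow> speed 0) (at_right 0)"
      unfolding add_0_right
    proof (rule Lim_transform_eventually)
      show "\<forall>\<^sub>F t in at_right 0. speed 0 + (1 / norm (t - 0)) *\<^sub>R (g t - (g 0 + (t - 0) *\<^sub>R speed 0))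
          = g t /\<^sub>R t"
        using eventually_at_right_less[of "0 :: real"]
        by eventually_elim (simp add: g_0 scaleR_diff_right divide_inverse_commute)
    qed
    moreover have "(speed \<longlongrightarrow> speed 0) (at_right 0)"
      using speed_continuous by (auto simp: continuous_on_def intro: tendsto_within_subset[of _ _ 0 "{0..}"])
    ultimately have "((\<lambda>t. speed t / (g t /\<^sub>R t)) \<longlongrightarrow> speed 0 / speed 0) (at_right 0)"
      by (intro tendsto_divide) (simp_all add: speed_nonzero)
    then have "((\<lambda>t. (speed t / (g t /\<^sub>R t)) *\<^sub>m F 0 t) \<longlongrightarrow> 1 *\<^sub>m l) (at_right 0)"
      using tendsto_cscale[OF _ l] by (simp add: speed_nonzero)
    then have "((\<lambda>t. t *\<^sub>R w 0 t) \<longlongrightarrow> l) (at_right 0)"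
      unfolding cscale_one
    proof (rule Lim_transform_eventually)
      show "\<forall>\<^sub>F t in at_right 0. (speed t / (g t /\<^sub>R t)) *\<^sub>m F 0 t = t *\<^sub>R w 0 t"
        unfolding eventually_at_right_field
        by (auto simp: F_def w_def cscale_cscale scaleR_eq_cscale g_nonzero scaleR_conv_of_real field_simps intro!: exI[of _ 1])
    qed
    with w_has_integral[of 0] have "l = 0"
      by (intro integrable_imp_residue_zero) auto
    with l 0 show ?thesis by simp
  qed
  obtain l where l: "(F k \<longlongrightarrow> l) (at_right 0)" "(F k \<longlongrightarrow> l + integral {0..} (?f k)) at_top"
    using ex by blast
  have "l = 0"
    using tendsto_unique[OF _ l(1) zero] by simp
  moreover have "l + integral {0..} (?f k) = 0"
    using tendsto_unique[OF _ l(2) inf] by simp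
  ultimately show ?thesis
    using integral_unique[OF int[of k]] by simp
qed

text \<open>\<open>K\<close> is the inverse of W at g(1). There W is nonsingular: W(g(1)) X = 0
  would propagate along the curve and give \<open>m 0 ** X = 0\<close>. For X commuting with A and
  C, the difference X W K - W K X solves the same equation as W and vanishes at t = 1, hence
  everywhere; integration gives the claim.\<close>

lemma commuting_moments:
  assumes m0: "invertible (m 0)"
  obtains K where "invertible K"
    "\<And>X k. X ** A = A ** X \<Longrightarrow> X ** C = C ** X \<Longrightarrow> X ** (m k ** K) = m k ** (K ** X)"
proof -
  let ?N = "\<lambda>t. (speed t / g t) *\<^sub>m (A + g t ^ 2 *\<^sub>m C)"
  have W1: "invertible (W (g 1))"
  proof (rule invertible_if_right_mult_eq_0)
    fix X :: "complex ^ 'n ^ 'n" assume X: "W (g 1) ** X = 0"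
    have "W (g t) ** X = 0" if "t > 0" for t
    proof (rule linear_matrix_ode_unique[where Y = "\<lambda>t. W (g t) ** X" and N = ?N and u = 1])
      fix s :: real assume "s > 0"
      from bounded_linear.has_vector_derivative[OF bounded_linear_matrix_mult_right W_ode[OF this]]
      show "((\<lambda>s. W (g s) ** X) has_vector_derivative ?N s ** (W (g s) ** X)) (at s)"
        unfolding matrix_mul_assoc .
    qed (use that X continuous_on_ode_coeff in auto)
    then have "m 0 ** X = 0"
      using linear_integral_eq[OF bounded_linear_matrix_mult_right[of X] bounded_linear_zero, of 0]
      by (simp add: w_def matrix_simps)
    then show "X = 0"
      using invertible_matrix_inv_mult(2)[OF m0] by (metis matrix_mul_assoc matrix_mul_lid matrix_mult_simps(7))
  qed
  define K where "K = matrix_inv (W (g 1))"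
  have K: "W (g 1) ** K = mat 1" "invertible K"
    using W1 by (simp_all add: K_def invertible_matrix_inv_mult)
  have "X ** (m k ** K) = m k ** (K ** X)" if X: "X ** A = A ** X" "X ** C = C ** X" for X k
  proof -
    have comm: "X ** (?N s ** Y) = ?N s ** (X ** Y)" for s Y
    proof -
      have "X ** ?N s = ?N s ** X"
        by (simp add: matrix_simps X)
      then show ?thesis by (simp add: matrix_mul_assoc)
    qed
    have W: "X ** (W (g t) ** K) - W (g t) ** (K ** X) = 0" if "t > 0" for t
    proof (rule linear_matrix_ode_unique[where Y = "\<lambda>t. X ** (W (g t) ** K) - W (g t) ** (K ** X)"
          and N = ?N and u = 1])
      fix s :: real assume "s > 0"
      note d = W_ode[OF this]
      have "((\<lambda>s. X ** (W (g s) ** K)) has_vector_derivative X ** ((?N s ** W (g s)) ** K)) (at s)"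
        by (rule bounded_linear.has_vector_derivative[OF bounded_linear_matrix_mult_left
            bounded_linear.has_vector_derivative[OF bounded_linear_matrix_mult_right d]])
      moreover have "((\<lambda>s. W (g s) ** (K ** X)) has_vector_derivative (?N s ** W (g s)) ** (K ** X)) (at s)"
        by (rule bounded_linear.has_vector_derivative[OF bounded_linear_matrix_mult_right d])
      ultimately have "((\<lambda>s. X ** (W (g s) ** K) - W (g s) ** (K ** X)) has_vector_derivative
          X ** ((?N s ** W (g s)) ** K) - (?N s ** W (g s)) ** (K ** X)) (at s)"
        by (rule has_vector_derivative_diff)
      moreover have "X ** ((?N s ** W (g s)) ** K) - (?N s ** W (g s)) ** (K ** X)
          = ?N s ** (X ** (W (g s) ** K) - W (g s) ** (K ** X))"
        unfolding matrix_mul_assoc[symmetric] comm matrix_mult_simps(3) ..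
      ultimately show "((\<lambda>s. X ** (W (g s) ** K) - W (g s) ** (K ** X)) has_vector_derivative
          ?N s ** (X ** (W (g s) ** K) - W (g s) ** (K ** X))) (at s)"
        by simp
    next
      show "X ** (W (g 1) ** K) - W (g 1) ** (K ** X) = 0"
        by (simp add: K matrix_mul_assoc)
    qed (use that continuous_on_ode_coeff in auto)
    show ?thesis
    proof (rule linear_integral_eq[where ?L1.0 = "\<lambda>Y. X ** (Y ** K)" and ?L2.0 = "\<lambda>Y. Y ** (K ** X)"])
      show "bounded_linear (\<lambda>Y :: complex ^ 'n ^ 'n. X ** (Y ** K))"
        by (rule bounded_linear_compose[OF bounded_linear_matrix_mult_left[of X]
            bounded_linear_matrix_mult_right[of K]])
      show "bounded_linear (\<lambda>Y :: complex ^ 'n ^ 'n. Y ** (K ** X))"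
        by (rule bounded_linear_matrix_mult_right)
      show "X ** (w k t ** K) = w k t ** (K ** X)" if "t > 0" for t
        using W[OF that] by (simp add: w_def matrix_simps)
    qed
  qed
  with K(2) show ?thesis by (rule that)
qed

end

section \<open>From orthogonal polynomials to coefficient sequences\<close>

lemma (in pearson_weight) laguerre_recursion_moments:
  assumes orthogonal: "left_orthogonal_polys g W P H"
    and recursion: "recursion_coefficients P H \<beta> \<gamma>"
  obtains a where
    "laguerre_recursion A C (\<lambda>k. (1 / (2 * of_real pi * \<i>)) *\<^sub>m m k) a (\<lambda>n. matrix_inv (H n)) \<beta> \<gamma>"
proof -
  let ?c = "1 / (2 * of_real pi * \<i>) :: complex"
  have inv: "invertible (H n)" for n
    using orthogonal by (simp add: left_orthogonal_polys_def)
  have "\<exists>a. a n = mat 1 \<and> (\<forall>k>n. a k = 0) \<and> (\<forall>z. P n z = (\<Sum>k\<le>n. z ^ k *\<^sub>m a k))" for n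
  proof -
    obtain a where a: "a n = mat 1" "\<And>z. P n z = (\<Sum>k\<le>n. z ^ k *\<^sub>m a k)"
      using orthogonal unfolding left_orthogonal_polys_def monic_matrix_poly_def by blast
    show ?thesis
      \<comment> \<open>Coefficients beyond the degree are set to zero, so that sums can later be
        padded to a common length.\<close>
      by (rule exI[of _ "\<lambda>k. if k \<le> n then a k else 0"]) (simp add: a)
  qed
  then obtain a where lead: "\<And>n. a n n = mat 1" and degree: "\<And>n k. n < k \<Longrightarrow> a n k = 0"
    and P: "\<And>n z. P n z = (\<Sum>k\<le>n. z ^ k *\<^sub>m a n k)"
    by metis
  have P': "P n z = (\<Sum>k\<le>N. z ^ k *\<^sub>m a n k)" if "n \<le> N" for n N z
    unfolding P by (rule sum.mono_neutral_left) (use that degree in \<open>auto simp: cscale_zero_right\<close>)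
  have cscale_sum: "c *\<^sub>m (\<Sum>k\<in>I. f k) = (\<Sum>k\<in>I. c *\<^sub>m f k)"
    for c and I :: "nat set" and f :: "nat \<Rightarrow> complex ^ 'n ^ 'n"
    by (induction I rule: infinite_finite_induct) (simp_all add: cscale_simps)
  have shift: "z *\<^sub>m P n z = (\<Sum>k\<le>N. z ^ k *\<^sub>m prev (a n) k)" if "n < N" for n N z
  proof -
    obtain N' where N: "N = Suc N'" "n \<le> N'" using \<open>n < N\<close> by (cases N) auto
    show ?thesis
      unfolding N(1) P'[OF N(2)]
      by (subst sum.atMost_Suc_shift) (simp add: cscale_sum cscale_simps)
  qed
  show ?thesis
  proof (rule that[of a], unfold_locales)
    fix k
    have "?c *\<^sub>m (of_nat (k + 1) *\<^sub>m m k + A ** m k + C ** m (k + 2)) = 0"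
      unfolding moment_identity by (rule cscale_zero_right)
    then show "of_nat (k + 1) *\<^sub>m ?c *\<^sub>m m k + A ** (?c *\<^sub>m m k) + C ** (?c *\<^sub>m m (k + 2)) = 0"
      by (simp only: cscale_add_right cscale_cscale cscale_mult_right mult.commute)
  next
    show "a n n = mat 1" for n by (rule lead)
    show "a n k = 0" if "n < k" for n k using that by (rule degree)
    show "invertible (matrix_inv (H n))" for n
      using inv by (rule invertible_matrix_inv_mult)
    show "\<gamma> 0 = 0"
      using recursion by (simp add: recursion_coefficients_def matrix_mult_simps)
  next
    fix k n :: nat assume "k \<le> n"
    have "((\<lambda>t. \<Sum>j\<le>n. a n j ** w (j + k) t) has_integral (\<Sum>j\<le>n. a n j ** m (j + k))) {0..}"
      by (intro has_integral_sum finite_atMost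
          has_integral_linear[OF w_has_integral bounded_linear_matrix_mult_left, unfolded o_def])
    moreover have "(\<Sum>j\<le>n. a n j ** w (j + k) t) = speed t *\<^sub>m g t ^ k *\<^sub>m (P n (g t) ** W (g t))" for t
      unfolding P matrix_mult_sum_left cscale_sum
      by (rule sum.cong) (simp_all add: w_def matrix_simps power_add mult_ac)
    ultimately have "curve_integral g (\<lambda>z. z ^ k *\<^sub>m (P n z ** W z)) = (\<Sum>j\<le>n. a n j ** m (j + k))"
      unfolding curve_integral_def speed_def[symmetric] by (simp add: integral_unique)
    moreover have "?c *\<^sub>m curve_integral g (\<lambda>z. z ^ k *\<^sub>m (P n z ** W z))
        = (if k = n then matrix_inv (H n) else 0)"
      using orthogonal \<open>k \<le> n\<close> unfolding left_orthogonal_polys_def by blast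
    ultimately show "(\<Sum>j\<le>n. a n j ** (?c *\<^sub>m m (j + k))) = (if k = n then matrix_inv (H n) else 0)"
      by (simp add: cscale_sum cscale_mult_right)
  next
    fix n k
    \<comment> \<open>Large enough for z P_n and P_{n+1}, and for the index k to lie in the range of
      comparison.\<close>
    define N where "N = Suc n + k"
    have "(\<Sum>k\<le>N. z ^ k *\<^sub>m prev (a n) k)
        = (\<Sum>k\<le>N. z ^ k *\<^sub>m (a (Suc n) k + \<beta> n ** a n k + \<gamma> n ** prev (\<lambda>m. a m k) n))" for z
    proof -
      have prevP: "prev (\<lambda>m. P m z) n = (\<Sum>k\<le>N. z ^ k *\<^sub>m prev (\<lambda>m. a m k) n)"
        by (cases n) (simp_all add: cscale_zero_right P'[of _ N] N_def)
      have "z *\<^sub>m P n z = P (Suc n) z + \<beta> n ** P n z + \<gamma> n ** prev (\<lambda>m. P m z) n"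
        using recursion by (simp add: recursion_coefficients_def)
      moreover have "n < N" "Suc n \<le> N" "n \<le> N" by (simp_all add: N_def)
      ultimately show ?thesis
        unfolding prevP unfolding shift[OF \<open>n < N\<close>]
        unfolding P'[OF \<open>Suc n \<le> N\<close>] P'[OF \<open>n \<le> N\<close>]
        by (simp only: matrix_mult_sum_right cscale_simps sum.distrib)
    qed
    then show "prev (a n) k = a (Suc n) k + \<beta> n ** a n k + \<gamma> n ** prev (\<lambda>m. a m k) n"
      by (rule matrix_poly_eq_coeffs[where n = N]) (simp add: N_def)
  qed
qed

theorem theorem6:
  fixes A\<^sub>L B\<^sub>L C\<^sub>L :: "complex ^ 'n ^ 'n"
    and g :: "real \<Rightarrow> complex"
    and W :: "complex \<Rightarrow> complex ^ 'n ^ 'n"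
    and P :: "nat \<Rightarrow> complex \<Rightarrow> complex ^ 'n ^ 'n"
    and H \<beta> \<gamma> :: "nat \<Rightarrow> complex ^ 'n ^ 'n"
  assumes curve: "laguerre_curve g"
    and weight: "laguerre_weight g W"
    and regular: "regular_weight g W"
    and pearson: "pearson_equation g W A\<^sub>L B\<^sub>L C\<^sub>L"
    and orthogonal: "left_orthogonal_polys g W P H"
    and recursion: "recursion_coefficients P H \<beta> \<gamma>"
    and B_zero: "B\<^sub>L = 0"
  shows
    "(\<forall>n. mat (of_nat (2 * n + 1)) + A\<^sub>L + C\<^sub>L ** (\<gamma> (n + 1) + \<gamma> n) + C\<^sub>L ** (\<beta> n ** \<beta> n) =
        commutator (\<Sum>k<n. \<beta> k) C\<^sub>L ** (\<Sum>k\<le>n. \<beta> k)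
        - commutator ((\<Sum>i<n. \<Sum>j<i. \<beta> i ** \<beta> j) - (\<Sum>k<n. \<gamma> k)) C\<^sub>L) \<and>
     (\<forall>n. \<beta> n - \<gamma> n ** (C\<^sub>L ** (\<beta> n + prev \<beta> n)) + (C\<^sub>L ** (\<beta> n + \<beta> (n + 1))) ** \<gamma> (n + 1) =
        - (\<gamma> n ** commutator (\<Sum>k<n - 1. \<beta> k) C\<^sub>L)
        + commutator (\<Sum>k<n. \<beta> k) C\<^sub>L ** \<gamma> (n + 1)) \<and>
     (abelian_set {A\<^sub>L, C\<^sub>L} \<longrightarrow>
        abelian_set ({A\<^sub>L, C\<^sub>L} \<union> range \<beta> \<union> range \<gamma>) \<and>
        (\<forall>n. mat (of_nat (2 * n + 1)) + A\<^sub>L + C\<^sub>L ** (\<gamma> (n + 1) + \<gamma> n) + C\<^sub>L ** (\<beta> n ** \<beta> n) = 0) \<and>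
        (\<forall>n. \<beta> n - \<gamma> n ** (C\<^sub>L ** (\<beta> n + prev \<beta> n))
             + (C\<^sub>L ** (\<beta> n + \<beta> (n + 1))) ** \<gamma> (n + 1) = 0) \<and>
        dPIV A\<^sub>L C\<^sub>L \<gamma>)"
proof -
  interpret pw: pearson_weight g W A\<^sub>L C\<^sub>L
  proof
    show "laguerre_curve g" by (rule curve)
    show "pearson_equation g W A\<^sub>L 0 C\<^sub>L" using pearson by (simp only: B_zero)
    show "curve_integrable g (\<lambda>z. z ^ k *\<^sub>m W z)" for k
      using regular unfolding regular_weight_def by (elim conjE) (erule spec)
  qed
  let ?c = "1 / (2 * of_real pi * \<i>) :: complex"
  obtain a where "laguerre_recursion A\<^sub>L C\<^sub>L (\<lambda>k. ?c *\<^sub>m pw.m k) a (\<lambda>n. matrix_inv (H n)) \<beta> \<gamma>"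
    using pw.laguerre_recursion_moments[OF orthogonal recursion] by blast
  then interpret lr: laguerre_recursion A\<^sub>L C\<^sub>L "\<lambda>k. ?c *\<^sub>m pw.m k" a "\<lambda>n. matrix_inv (H n)" \<beta> \<gamma> .
  have inv_\<gamma>: "invertible (\<gamma> (Suc n))" for n
  proof -
    have "\<gamma> (Suc n) = matrix_inv (H (Suc n)) ** H n"
      using recursion by (simp add: recursion_coefficients_def)
    then show ?thesis
      using orthogonal
      by (simp add: invertible_mult invertible_matrix_inv_mult left_orthogonal_polys_def)
  qed
  \<comment> \<open>\<open>m 0\<close> is a nonzero multiple of the inverse of
    \<open>H 0\<close>.\<close>
  have inv_m: "invertible (pw.m 0)"
  proof (rule invertible_if_left_mult_eq_0)
    fix X :: "complex ^ 'n ^ 'n" assume "X ** pw.m 0 = 0"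
    then have "X ** (?c *\<^sub>m pw.m 0) = 0"
      by (simp add: cscale_mult_right cscale_zero_right)
    then have "X ** matrix_inv (H 0) = 0"
      unfolding lr.M_0 .
    then show "X = 0"
      by (rule invertible_cancel_right[OF lr.invertible_G])
  qed
  have abelian: "abelian_set ({A\<^sub>L, C\<^sub>L} \<union> range \<beta> \<union> range \<gamma>)" if "abelian_set {A\<^sub>L, C\<^sub>L}"
  proof -
    obtain K where K: "invertible K" "\<And>X k. X ** A\<^sub>L = A\<^sub>L ** X \<Longrightarrow> X ** C\<^sub>L = C\<^sub>L ** X \<Longrightarrow>
        X ** (pw.m k ** K) = pw.m k ** (K ** X)"
      using pw.commuting_moments[OF inv_m] by blast
    show ?thesis
    proof (rule lr.abelian_recursion_coeffs[OF K(1)])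
      show "X ** ((?c *\<^sub>m pw.m k) ** K) = (?c *\<^sub>m pw.m k) ** (K ** X)" if "X \<in> lr.commutant" for X k
        using K(2)[of X k] that by (simp add: lr.commutant_def cscale_mult_left cscale_mult_right)
      show "A\<^sub>L ** C\<^sub>L = C\<^sub>L ** A\<^sub>L"
        using \<open>abelian_set {A\<^sub>L, C\<^sub>L}\<close> unfolding abelian_set_def by blast
    qed
  qed
  note dPIV = lr.dPIV_if_abelian[OF abelian inv_\<gamma>]
  show ?thesis
    unfolding mat_eq_cscale[of "of_nat _"]
    by (intro conjI allI impI lr.first_equation lr.second_equation abelian dPIV)
qed

end
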